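(* Let $Q=(q(i,j))_{i,j\in\mathbb{Z}_+}$ be an ergodic generator, partitioned into levels $L_0,L_1,\dots$ with blocks $Q_{k,\ell}$, with stationary distribution vector $\pi=(\pi_0,\pi_1,\dots)$, and suppose that $Q$ is in upper block-Hessenberg form, i.e. $Q_{k,\ell}=O$ whenever $\ell\le k-2$. For each $s\in\mathbb{Z}_+$ let $\alpha_s$ be a $1\times m_s$ probability vector, ${}_{(s)}\widehat\alpha=(0,\dots,0,\alpha_s)$ (the $1\times(n_s+1)$ vector with $\alpha_s$ placed on level $L_s$), and $${}_{(s)}\widehat Q={}_{(s)}Q-({}_{(s)}Qe)\,{}_{(s)}\widehat\alpha,\qquad {}_{(s)}\widehat\pi=\frac{{}_{(s)}\widehat\alpha(-{}_{(s)}Q)^{-1}}{{}_{(s)}\widehat\alpha(-{}_{(s)}Q)^{-1}e}.$$ Suppose there exist $b,b'\in(0,\infty)$, a column vector $v=(v(i))_{i\in\mathbb{Z}_+}$ with $v(i)\ge1$ for all $i$, and a finite set $C\subset\mathbb{Z}_+$ such that: (1) $\sum_{j\in\mathbb{Z}_+}q(i,j)v(j)\le -|q(i,i)|-1+b\,1_C(i)$ for all $i\in\mathbb{Z}_+$; (2) $\sum_{j=0}^{n_s}[{}_{(s)}\widehat Q]_{i,j}v(j)\le -|q(i,i)|-1+b'\,1_C(i)$ for all $s\in\mathbb{Z}_+$ and $i\in\{0,\dots,n_s\}$; (3) $\lim_{s\to\infty}\sum_{j=0}^{n_s}[{}_{(s)}\widehat Q]_{i,j}v(j)=\sum_{j\in\mathbb{Z}_+}q(i,j)v(j)$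 for every $i\in\mathbb{Z}_+$; (4) $\displaystyle\sup_{i\in\mathbb{Z}_+\setminus C}\Big\{\sum_{j\in\mathbb{Z}_+\setminus C}\frac{q(i,j)}{|q(i,i)|+1}\max(v(j)-v(i),0)\Big\}<\infty$. Then $$\lim_{s\to\infty}\|{}_{(s)}\widehat\pi-\pi\|=0,$$ and thus $$\pi_k=\lim_{s\to\infty}\frac{\alpha_sU_s^*U_{s,k}}{\alpha_s\sum_{\ell=0}^sU_s^*U_{s,\ell}e},\qquad k\in\mathbb{Z}_+ .$$
   Context: $\mathbb{Z}_+=\{0,1,2,\dots\}$. An ergodic generator is the infinitesimal generator ($Q$-matrix) $Q=(q(i,j))_{i,j\in\mathbb{Z}_+}$ of an ergodic (irreducible and positive recurrent, hence non-explosive) continuous-time Markov chain on $\mathbb{Z}_+$; thus $\sum_{j}q(i,j)=0$, $q(i,i)\in(-\infty,0)$ and $q(i,j)\ge 0$ for $j\ne i$. Its stationary distribution vector $\pi$ is the unique positive row vector with $\pi Q=0$ and $\pi e=1$, where $e$ is a column vector of ones of appropriate order. $1_C$ is the indicator function of $C$. For a row vector $x=(x(j))$, $\|x\|=\sum_j|x(j)|$; finite vectors are extended to vectors indexed by $\mathbb{Z}_+$ by appending zeros. Levels: let $m_0,m_1,\dots$ be positive integers, $n_{-1}=-1$, $n_s=\sum_{\ell=0}^sm_\ell-1$, and $L_s=\{n_{s-1}+1,\dots,n_s\}$ (level $s$, of cardinality $m_s$). Then $Q_{k,\ell}=(q(i,j))_{i\in L_k,j\in L_\ell}$, $\pi_k=(\pi(i))_{i\in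 L_k}$, and ${}_{(s)}Q=(q(i,j))_{0\le i,j\le n_s}$, which is nonsingular with $(-{}_{(s)}Q)^{-1}\ge O$. For upper block-Hessenberg $Q$, define recursively $$U_0^*=(-Q_{0,0})^{-1},\qquad U_k^*=\Big(-Q_{k,k}-\sum_{\ell=0}^{k-1}U_{k,\ell}Q_{\ell,k}\Big)^{-1},\quad k\ge1,$$ where $U_{k,\ell}=(Q_{k,k-1}U_{k-1}^* )(Q_{k-1,k-2}U_{k-2}^* )\cdots(Q_{\ell+1,\ell}U_\ell^* )$ for $0\le\ell\le k-1$, and $U_{k,k}=I$. (The inverses exist.) *)

theory Defs
  imports
    "HOL-Probability.Probability_Measure"
    "Jordan_Normal_Form.Gauss_Jordan_Elimination"
begin

section \<open>Ergodic generators on the nonnegative integers\<close>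

(* Right-continuous paths (for the discrete topology on nat) with finitely many jumps in bounded
   time; the second clause is non-explosiveness. Only times t >= 0 matter. *)
definition step_path :: "(real \<Rightarrow> nat) \<Rightarrow> bool" where
  "step_path f \<longleftrightarrow>
     (\<forall>t\<ge>0. continuous (at_right t) f) \<and>
     (\<forall>T. finite {t. 0 < t \<and> t \<le> T \<and> \<not> isCont f t})"

(* P i is the law of the chain started in i. *)
definition ctmc :: "(nat \<Rightarrow> 'w measure) \<Rightarrow> (real \<Rightarrow> 'w \<Rightarrow> nat) \<Rightarrow> bool" where
  "ctmc P X \<longleftrightarrow>
     (\<forall>i. prob_space (P i)) \<and>
     (\<forall>i. sets (P i) = sets (P 0)) \<and>
     (\<forall>i. \<forall>t\<ge>0. X t \<in> measurable (P i) (count_space UNIV)) \<and>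
     (\<forall>i. \<forall>\<omega>\<in>space (P i). step_path (\<lambda>t. X t \<omega>)) \<and>
     (\<forall>i. measure (P i) {\<omega> \<in> space (P i). X 0 \<omega> = i} = 1) \<and>
     (\<forall>i n (t :: nat \<Rightarrow> real) (x :: nat \<Rightarrow> nat). 0 \<le> t 0 \<longrightarrow> (\<forall>k\<le>n. t k < t (Suc k)) \<longrightarrow>
        measure (P i) {\<omega> \<in> space (P i). \<forall>k\<le>Suc n. X (t k) \<omega> = x k} =
        measure (P i) {\<omega> \<in> space (P i). \<forall>k\<le>n. X (t k) \<omega> = x k} *
        measure (P (x n)) {\<omega> \<in> space (P (x n)). X (t (Suc n) - t n) \<omega> = x (Suc n)})"

definition trans_prob ::
  "(nat \<Rightarrow> 'w measure) \<Rightarrow> (real \<Rightarrow> 'w \<Rightarrow> nat) \<Rightarrow> real \<Rightarrow> nat \<Rightarrow> nat \<Rightarrow> real" where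
  "trans_prob P X t i j = measure (P i) {\<omega> \<in> space (P i). X t \<omega> = j}"

definition ctmc_irreducible :: "(nat \<Rightarrow> 'w measure) \<Rightarrow> (real \<Rightarrow> 'w \<Rightarrow> nat) \<Rightarrow> bool" where
  "ctmc_irreducible P X \<longleftrightarrow> (\<forall>i j. \<exists>t>0. trans_prob P X t i j > 0)"

(* First time the path is in i after having left i; infinite if there is none. *)
definition return_time :: "nat \<Rightarrow> (real \<Rightarrow> nat) \<Rightarrow> ennreal" where
  "return_time i f = Inf {ennreal t |t. 0 < t \<and> f t = i \<and> (\<exists>u. 0 \<le> u \<and> u < t \<and> f u \<noteq> i)}"

definition ctmc_positive_recurrent ::
  "(nat \<Rightarrow> 'w measure) \<Rightarrow> (real \<Rightarrow> 'w \<Rightarrow> nat) \<Rightarrow> bool" where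
  "ctmc_positive_recurrent P X \<longleftrightarrow>
     (\<forall>i. (\<integral>\<^sup>+ \<omega>. return_time i (\<lambda>t. X t \<omega>) \<partial>P i) < \<infinity>)"

definition ctmc_generator ::
  "(nat \<Rightarrow> 'w measure) \<Rightarrow> (real \<Rightarrow> 'w \<Rightarrow> nat) \<Rightarrow> (nat \<Rightarrow> nat \<Rightarrow> real) \<Rightarrow> bool" where
  "ctmc_generator P X q \<longleftrightarrow>
     (\<forall>i j. ((\<lambda>h. (trans_prob P X h i j - (if i = j then 1 else 0)) / h) \<longlongrightarrow> q i j) (at_right 0))"

definition conservative_Q_matrix :: "(nat \<Rightarrow> nat \<Rightarrow> real) \<Rightarrow> bool" where
  "conservative_Q_matrix q \<longleftrightarrow>
     (\<forall>i. q i i < 0) \<and> (\<forall>i j. j \<noteq> i \<longrightarrow> 0 \<le> q i j) \<and> (\<forall>i. (\<lambda>j. q i j) sums 0)"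

(* Taking the sample space inside the path type real => nat is no restriction: a chain on any
   sample space can be replaced by its laws on path space. The Q-matrix conditions follow from the
   other clauses and are listed for convenience. *)
definition ergodic_generator :: "(nat \<Rightarrow> nat \<Rightarrow> real) \<Rightarrow> bool" where
  "ergodic_generator q \<longleftrightarrow>
     conservative_Q_matrix q \<and>
     (\<exists>(P :: nat \<Rightarrow> (real \<Rightarrow> nat) measure) X.
        ctmc P X \<and> ctmc_irreducible P X \<and> ctmc_positive_recurrent P X \<and> ctmc_generator P X q)"

definition stationary_distribution :: "(nat \<Rightarrow> nat \<Rightarrow> real) \<Rightarrow> (nat \<Rightarrow> real) \<Rightarrow> bool" where
  "stationary_distribution q \<pi> \<longleftrightarrow>
     (\<forall>i. 0 < \<pi> i) \<and> (\<forall>j. (\<lambda>i. \<pi> i * q i j) sums 0) \<and> \<pi> sums 1"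

section \<open>Matrix conventions\<close>

(* Row vectors are matrices with one row, column vectors matrices with one column. *)

definition ones_col :: "nat \<Rightarrow> real mat" where
  "ones_col n = Matrix.mat n 1 (\<lambda>_. 1)"

(* The value of mat_inv is meaningful for nonsingular A only. *)
abbreviation mat_inv :: "real mat \<Rightarrow> real mat" where
  "mat_inv A \<equiv> the (mat_inverse A)"

(* F 0 + ... + F (n - 1) for matrices F l of format nr x nc; library matrices of varying format
   do not form a type-class monoid, so the big operators do not apply. *)
definition mat_sum :: "nat \<Rightarrow> nat \<Rightarrow> (nat \<Rightarrow> real mat) \<Rightarrow> nat \<Rightarrow> real mat" where
  "mat_sum nr nc F n = Matrix.mat nr nc (\<lambda>ij. \<Sum>l<n. F l $$ ij)"

definition prob_row :: "nat \<Rightarrow> real mat \<Rightarrow> bool" where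
  "prob_row n a \<longleftrightarrow> a \<in> carrier_mat 1 n \<and> (\<forall>j<n. 0 \<le> a $$ (0, j)) \<and> (\<Sum>j<n. a $$ (0, j)) = 1"

definition extend_row :: "real mat \<Rightarrow> nat \<Rightarrow> real" where
  "extend_row x j = (if j < dim_col x then x $$ (0, j) else 0)"

definition l1_norm :: "(nat \<Rightarrow> real) \<Rightarrow> real" where
  "l1_norm x = (\<Sum>j. \<bar>x j\<bar>)"

section \<open>Levels and block-Hessenberg generators\<close>

(* level_start m s = n_{s-1} + 1 and level_start m (Suc s) = n_s + 1, so that
   {0, ..., n_s} = {..<level_start m (Suc s)}. *)
definition level_start :: "(nat \<Rightarrow> nat) \<Rightarrow> nat \<Rightarrow> nat" where
  "level_start m s = (\<Sum>l<s. m l)"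

definition level :: "(nat \<Rightarrow> nat) \<Rightarrow> nat \<Rightarrow> nat set" where
  "level m s = {level_start m s..<level_start m (Suc s)}"

definition block :: "(nat \<Rightarrow> nat) \<Rightarrow> (nat \<Rightarrow> nat \<Rightarrow> real) \<Rightarrow> nat \<Rightarrow> nat \<Rightarrow> real mat" where
  "block m q k l =
     Matrix.mat (m k) (m l) (\<lambda>(i, j). q (level_start m k + i) (level_start m l + j))"

definition row_block :: "(nat \<Rightarrow> nat) \<Rightarrow> (nat \<Rightarrow> real) \<Rightarrow> nat \<Rightarrow> real mat" where
  "row_block m x k = Matrix.mat 1 (m k) (\<lambda>(_, j). x (level_start m k + j))"

definition upper_block_Hessenberg :: "(nat \<Rightarrow> nat) \<Rightarrow> (nat \<Rightarrow> nat \<Rightarrow> real) \<Rightarrow> bool" where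
  "upper_block_Hessenberg m q \<longleftrightarrow> (\<forall>k l. l + 2 \<le> k \<longrightarrow> block m q k l = 0\<^sub>m (m k) (m l))"

(* The north-west corner truncation (s)Q *)
definition trunc_Q :: "(nat \<Rightarrow> nat) \<Rightarrow> (nat \<Rightarrow> nat \<Rightarrow> real) \<Rightarrow> nat \<Rightarrow> real mat" where
  "trunc_Q m q s =
     Matrix.mat (level_start m (Suc s)) (level_start m (Suc s)) (\<lambda>(i, j). q i j)"

definition alpha_hat :: "(nat \<Rightarrow> nat) \<Rightarrow> (nat \<Rightarrow> real mat) \<Rightarrow> nat \<Rightarrow> real mat" where
  "alpha_hat m \<alpha> s = Matrix.mat 1 (level_start m (Suc s))
     (\<lambda>(_, j). if j \<in> level m s then \<alpha> s $$ (0, j - level_start m s) else 0)"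

definition Q_hat ::
  "(nat \<Rightarrow> nat) \<Rightarrow> (nat \<Rightarrow> nat \<Rightarrow> real) \<Rightarrow> (nat \<Rightarrow> real mat) \<Rightarrow> nat \<Rightarrow> real mat" where
  "Q_hat m q \<alpha> s =
     trunc_Q m q s - (trunc_Q m q s * ones_col (level_start m (Suc s))) * alpha_hat m \<alpha> s"

definition pi_hat ::
  "(nat \<Rightarrow> nat) \<Rightarrow> (nat \<Rightarrow> nat \<Rightarrow> real) \<Rightarrow> (nat \<Rightarrow> real mat) \<Rightarrow> nat \<Rightarrow> real mat" where
  "pi_hat m q \<alpha> s =
     (let x = alpha_hat m \<alpha> s * mat_inv (- trunc_Q m q s)
      in (1 / (x * ones_col (level_start m (Suc s))) $$ (0, 0)) \<cdot>\<^sub>m x)"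

(* U_star m q k is U_k^* and U_mat m q k l is U_{k,l}; the products defining the latter are
   unfolded from the left: U_{k,l} = (Q_{k,k-1} U_{k-1}^* ) U_{k-1,l} for l < k. Arguments l > k
   do not occur in the theory. *)
function (sequential)
  U_star :: "(nat \<Rightarrow> nat) \<Rightarrow> (nat \<Rightarrow> nat \<Rightarrow> real) \<Rightarrow> nat \<Rightarrow> real mat" and
  U_mat :: "(nat \<Rightarrow> nat) \<Rightarrow> (nat \<Rightarrow> nat \<Rightarrow> real) \<Rightarrow> nat \<Rightarrow> nat \<Rightarrow> real mat"
where
  "U_star m q 0 = mat_inv (- block m q 0 0)"
| "U_star m q (Suc k) = mat_inv (- block m q (Suc k) (Suc k)
     - mat_sum (m (Suc k)) (m (Suc k))
         (\<lambda>l. U_mat m q (Suc k) l * block m q l (Suc k)) (Suc k))"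
| "U_mat m q 0 l = 1\<^sub>m (m 0)"
| "U_mat m q (Suc k) l =
     (if l \<le> k then (block m q (Suc k) k * U_star m q k) * U_mat m q k l
      else 1\<^sub>m (m (Suc k)))"
  by pat_completeness auto
termination
  by (relation "Wellfounded.measure (\<lambda>z. case z of Inl (m, q, k) \<Rightarrow> 2 * k + 1 | Inr (m, q, k, l) \<Rightarrow> 2 * k)") auto

end

theory Submission
  imports Defs "Jordan_Normal_Form.Determinant" "HOL-Real_Asymp.Real_Asymp"
begin

text \<open>Any pointwise subsequential limit \<open>\<mu>\<close> of the truncated stationary vectors is invariant, because the
  columns of a Hessenberg generator have finite support. Averaging condition (2) against these vectors bounds
  the mean jump rate of \<open>\<mu>\<close> and bounds \<open>\<mu> (C)\<close> below, so \<open>\<mu>\<close> is a positive multiple of \<open>\<pi>\<close> by uniqueness of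
  invariant measures. No mass is lost: condition (4) gives \<open>\<mu> Q v = 0\<close>, and comparison with the exact
  identities at level \<open>s\<close> through (2) and (3) yields tightness, in the manner of Scheffe's lemma. The formula
  with \<open>U_star\<close> is block elimination: the blocks \<open>U_star s * U_mat s l\<close> form the last block row of the
  inverse of minus the truncation.\<close>

section \<open>Irreducibility of the Q-matrix\<close>

text \<open>Neither \<open>v\<close> nor the jump rates are assumed integrable under \<pi>, so
  identities such as \<pi> Q v = 0 cannot be had by interchanging sums. Two asymmetries get around
  this. In the uniqueness of invariant measures only one of the two measures must have a finite mean
  jump rate: the limit \<mu> gets such a bound from condition (2), and \<pi> plays the unrestricted
  part. And letting \<open>s\<close> tend to infinity in the identities for the truncations gives,
  by Fatou, only \<mu> Q v \<ge> 0; equality comes from testing \<mu> against the bounded functions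
  \<open>min v n\<close>, where condition (4) limits the upward drift and, since \<mu> Q v is
  already known to converge, the downward drift as well. Irreducibility is wanted for the rates but
  given for transition probabilities; this translation is what calls for path arguments. One sign
  comparison for truncated row vectors supplies the nonsingularity of the truncations and, by
  induction, the existence of every \<open>U_star\<close>.\<close>

definition closed_states :: "(nat \<Rightarrow> nat \<Rightarrow> real) \<Rightarrow> nat set \<Rightarrow> bool" where
  "closed_states q S \<longleftrightarrow> (\<forall>i\<in>S. \<forall>j. j \<notin> S \<longrightarrow> q i j = 0)"

text \<open>Closed sets rather than chains of positive rates, because the sets to be excluded later
  arise whole: the support of an invariant measure and the states where a truncated row vector is
  negative.\<close>

definition Q_irreducible :: "(nat \<Rightarrow> nat \<Rightarrow> real) \<Rightarrow> bool" where
  "Q_irreducible q \<longleftrightarrow> (\<forall>S. closed_states q S \<longrightarrow> S \<noteq> {} \<longrightarrow> S = UNIV)"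

text \<open>Confines a path on a bounded interval to finitely many states, which keeps the later
  union bound over starting states finite.\<close>

lemma step_path_finite_range:
  assumes "step_path f"
  shows "finite (f ` {0..T})"
proof -
  define D where "D = {t. 0 < t \<and> t \<le> T \<and> \<not> isCont f t}"
  have D: "finite D"
    using assms unfolding step_path_def D_def by blast
  define A where "A = {0<..T} - D"
  \<comment> \<open>Off the jump set \<open>D\<close>, the value \<open>f u\<close> depends only on \<open>D \<inter> {..u}\<close>, a subset of a finite set.\<close>
  have const: "f u = f u'" if "u \<in> A" "u' \<in> A" "u \<le> u'" "D \<inter> {..u} = D \<inter> {..u'}" for u u'
  proof -
    \<comment> \<open>A jump in \<open>{u..u'}\<close> would lie in \<open>D \<inter> {..u}\<close>,
      hence be \<open>u\<close> itself, which \<open>A\<close> excludes.\<close>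
    have "isCont f t" if "t \<in> {u..u'}" for t
    proof (cases "t \<in> D")
      case True
      then have "t \<in> D \<inter> {..u}" using that \<open>D \<inter> {..u} = D \<inter> {..u'}\<close> by auto
      then have "t = u" using that by auto
      then show ?thesis using True \<open>u \<in> A\<close> by (auto simp: A_def)
    next
      case False
      then show ?thesis using that \<open>u \<in> A\<close> \<open>u' \<in> A\<close> by (auto simp: A_def D_def)
    qed
    then have "continuous_on {u..u'} f"
      by (simp add: continuous_at_imp_continuous_on)
    then have "connected (f ` {u..u'})"
      by (intro connected_continuous_image) auto
    then have "{f u} \<inter> f ` {u..u'} = {} \<or> - {f u} \<inter> f ` {u..u'} = {}"
      by (rule connectedD) (auto simp: open_discrete)
    then show ?thesis using \<open>u \<le> u'\<close> by force
  qed
  have const: "f u = f u'" if "u \<in> A" "u' \<in> A" "D \<inter> {..u} = D \<inter> {..u'}" for u u'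
  proof (cases "u \<le> u'")
    case True
    show ?thesis by (rule const[OF that(1,2) True that(3)])
  next
    case False
    then have "u' \<le> u" by simp
    show ?thesis by (rule sym, rule const[OF that(2,1) \<open>u' \<le> u\<close> that(3)[symmetric]])
  qed
  define g where "g E = f (SOME u. u \<in> A \<and> D \<inter> {..u} = E)" for E
  have "f u = g (D \<inter> {..u})" if "u \<in> A" for u
  proof -
    define w where "w = (SOME w. w \<in> A \<and> D \<inter> {..w} = D \<inter> {..u})"
    have "w \<in> A \<and> D \<inter> {..w} = D \<inter> {..u}"
      unfolding w_def by (rule someI[of _ u]) (use that in auto)
    then have "f w = f u" using const that by blast
    then show ?thesis by (simp add: g_def w_def)
  qed
  then have "f ` A \<subseteq> g ` Pow D" by blast
  then have "finite (f ` A)" using D finite_subset by blast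
  moreover have "f ` {0..T} \<subseteq> insert (f 0) (f ` A \<union> f ` D)"
  proof -
    have "{0..T} \<subseteq> insert 0 (A \<union> D)" by (auto simp: A_def)
    then show ?thesis by blast
  qed
  ultimately show ?thesis using D by (meson finite_Un finite_imageI finite_insert finite_subset)
qed

text \<open>Discretise \<open>[0, t]\<close> by the grid \<open>k t / n\<close>. A path that leaves \<open>S\<close> has a grid step out of \<open>S\<close>, and
  as a step path it visits only states below some \<open>m\<close> up to time \<open>t\<close>. From each of these finitely many
  states a step of length \<open>t / n\<close> leaves \<open>S\<close> with probability \<open>o(1 / n)\<close>.\<close>

lemma ctmc_exit_measure_zero:
  assumes ctmc: "ctmc P X" and gen: "ctmc_generator P X q"
    and cons: "conservative_Q_matrix q" and S: "closed_states q S" and i0: "i0 \<in> S" and t: "0 < t"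
  shows "measure (P i0) {\<omega> \<in> space (P i0). X t \<omega> \<notin> S} = 0"
proof -
  define M where "M = P i0"
  interpret prob_space M
    using ctmc by (auto simp: M_def ctmc_def)
  have X_meas: "X u \<in> measurable M (count_space UNIV)" if "0 \<le> u" for u
    using ctmc that by (auto simp: M_def ctmc_def)
  have X_sets [measurable]: "{\<omega> \<in> space M. Q (X u \<omega>)} \<in> events" if "0 \<le> u" for u Q
    using measurable_sets[OF X_meas[OF that], of "Collect Q"]
    by (simp add: vimage_def Int_def conj_commute)
  have X2_sets: "{\<omega> \<in> space M. Q (X u \<omega>) \<and> R (X w \<omega>)} \<in> events" if "0 \<le> u" "0 \<le> w" for u w Q R
  proof -
    have "{\<omega> \<in> space M. Q (X u \<omega>) \<and> R (X w \<omega>)} =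
        {\<omega> \<in> space M. Q (X u \<omega>)} \<inter> {\<omega> \<in> space M. R (X w \<omega>)}" by blast
    then show ?thesis using X_sets that by simp
  qed
  have markov: "prob {\<omega> \<in> space M. X u \<omega> = i \<and> X (u + h) \<omega> = j}
      = prob {\<omega> \<in> space M. X u \<omega> = i} * trans_prob P X h i j"
    if "0 \<le> u" "0 < h" for u h i j
  proof -
    have "\<forall>i n (t :: nat \<Rightarrow> real) (x :: nat \<Rightarrow> nat). 0 \<le> t 0 \<longrightarrow> (\<forall>k\<le>n. t k < t (Suc k)) \<longrightarrow>
        measure (P i) {\<omega> \<in> space (P i). \<forall>k\<le>Suc n. X (t k) \<omega> = x k} =
        measure (P i) {\<omega> \<in> space (P i). \<forall>k\<le>n. X (t k) \<omega> = x k} *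
        measure (P (x n)) {\<omega> \<in> space (P (x n)). X (t (Suc n) - t n) \<omega> = x (Suc n)}"
      using ctmc unfolding ctmc_def by blast
    note * = this[rule_format, where i = i0 and n = 0 and t = "\<lambda>k. if k = 0 then u else u + h"
        and x = "\<lambda>k. if k = 0 then i else j"]
    have le1: "(\<forall>k\<le>Suc 0. Q k) \<longleftrightarrow> Q 0 \<and> Q (Suc 0)" for Q :: "nat \<Rightarrow> bool"
      by (auto simp: le_Suc_eq)
    show ?thesis using * that by (simp add: M_def trans_prob_def le1)
  qed
  \<comment> \<open>Bounds the probability of being outside \<open>S\<close> after time
    \<open>h\<close>. The cut at \<open>g\<close> leaves a finite sum, so the generator limit
    applies term by term.\<close>
  define esc where "esc g i h = 1 - (\<Sum>j\<in>S \<inter> {..g}. trans_prob P X h i j)" for g i h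
  have leave: "prob {\<omega> \<in> space M. X u \<omega> = i \<and> X (u + h) \<omega> \<notin> S} \<le> esc g i h"
    if "0 \<le> u" "0 < h" for u h i g
  proof -
    have "prob {\<omega> \<in> space M. X u \<omega> = i \<and> X (u + h) \<omega> \<notin> S} \<le>
       prob ({\<omega> \<in> space M. X u \<omega> = i} - (\<Union>j\<in>S \<inter> {..g}. {\<omega> \<in> space M. X u \<omega> = i \<and> X (u + h) \<omega> = j}))"
      by (rule finite_measure_mono) (use that in \<open>auto intro!: X_sets X2_sets\<close>)
    also have "\<dots> = prob {\<omega> \<in> space M. X u \<omega> = i} -
        prob (\<Union>j\<in>S \<inter> {..g}. {\<omega> \<in> space M. X u \<omega> = i \<and> X (u + h) \<omega> = j})"
      by (rule finite_measure_Diff) (use that in \<open>auto intro!: X_sets X2_sets\<close>)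
    also have "prob (\<Union>j\<in>S \<inter> {..g}. {\<omega> \<in> space M. X u \<omega> = i \<and> X (u + h) \<omega> = j}) =
       (\<Sum>j\<in>S \<inter> {..g}. prob {\<omega> \<in> space M. X u \<omega> = i \<and> X (u + h) \<omega> = j})"
      by (rule finite_measure_finite_Union)
        (use that in \<open>auto intro!: X2_sets simp: disjoint_family_on_def\<close>)
    also have "\<dots> = prob {\<omega> \<in> space M. X u \<omega> = i} * (\<Sum>j\<in>S \<inter> {..g}. trans_prob P X h i j)"
      using that by (simp add: markov sum_distrib_left)
    also have "prob {\<omega> \<in> space M. X u \<omega> = i} - \<dots> = prob {\<omega> \<in> space M. X u \<omega> = i} * esc g i h"
      by (simp add: esc_def algebra_simps)
    finally have *: "prob {\<omega> \<in> space M. X u \<omega> = i \<and> X (u + h) \<omega> \<notin> S}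
      \<le> prob {\<omega> \<in> space M. X u \<omega> = i} * esc g i h" .
    \<comment> \<open>Allows the probability of \<open>X u \<omega> = i\<close> to be dropped as a
      factor, which makes the bound uniform in the grid time \<open>u\<close>.\<close>
    have "0 \<le> esc g i h"
    proof -
      interpret Pi: prob_space "P i" using ctmc by (auto simp: ctmc_def)
      have "\<forall>i. sets (P i) = sets (P 0)" using ctmc unfolding ctmc_def by blast
      then have sets_eq: "sets (P i) = sets M" unfolding M_def by metis
      then have "space (P i) = space M" by (rule sets_eq_imp_space_eq)
      with sets_eq
      have "(\<Sum>j\<in>S \<inter> {..g}. trans_prob P X h i j) =
         Pi.prob (\<Union>j\<in>S \<inter> {..g}. {\<omega> \<in> space (P i). X h \<omega> = j})"
        unfolding trans_prob_def
        by (intro Pi.finite_measure_finite_Union[symmetric])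
          (use that in \<open>auto intro!: X_sets simp: disjoint_family_on_def\<close>)
      then show ?thesis by (simp add: esc_def)
    qed
    then have "prob {\<omega> \<in> space M. X u \<omega> = i} * esc g i h \<le> esc g i h"
      by (intro mult_left_le_one_le) auto
    with * show ?thesis by simp
  qed
  have esc_lim: "((\<lambda>h. esc g i h / h) \<longlongrightarrow> - (\<Sum>j\<le>g. q i j)) (at_right 0)"
    if "i \<in> S" "i \<le> g" for i g
  proof -
    have "((\<lambda>h. - (\<Sum>j\<in>S \<inter> {..g}. (trans_prob P X h i j - (if i = j then 1 else 0)) / h))
        \<longlongrightarrow> - (\<Sum>j\<in>S \<inter> {..g}. q i j)) (at_right 0)"
      using gen by (intro tendsto_intros) (auto simp: ctmc_generator_def)
    moreover have "- (\<Sum>j\<in>S \<inter> {..g}. (trans_prob P X h i j - (if i = j then 1 else 0)) / h) = esc g i h / h" for h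
      using that by (simp add: esc_def sum_divide_distrib[symmetric] sum_subtractf divide_simps)
    \<comment> \<open>Closedness of \<open>S\<close> enters here: the added terms vanish, so the
      limit is a partial sum of a full row and tends to zero with \<open>g\<close>.\<close>
    moreover have "(\<Sum>j\<in>S \<inter> {..g}. q i j) = (\<Sum>j\<le>g. q i j)"
      using S that by (intro sum.mono_neutral_left) (auto simp: closed_states_def)
    ultimately show ?thesis by simp
  qed
  \<comment> \<open>Boundedness is demanded at grid times only, so that the event is a countable
    intersection and thus measurable.\<close>
  define R where "R m = {\<omega> \<in> space M. \<forall>n k. k \<le> n \<longrightarrow> X (real k * (t / real n)) \<omega> \<le> m}" for m
  have R_sets: "R m \<in> events" for m
  proof -
    have "R m = space M \<inter> (\<Inter>n. \<Inter>k\<in>{..n}. {\<omega> \<in> space M. X (real k * (t / real n)) \<omega> \<le> m})"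
      by (auto simp: R_def)
    also have "\<dots> \<in> events"
      using t by (intro sets.Int sets.top sets.countable_INT' X_sets) auto
    finally show ?thesis .
  qed
  have R_UN: "(\<Union>m. R m) = space M"
  proof -
    have "\<exists>m. \<omega> \<in> R m" if \<omega>: "\<omega> \<in> space M" for \<omega>
    proof -
      have "step_path (\<lambda>u. X u \<omega>)" using ctmc \<omega> by (auto simp: ctmc_def M_def)
      then have "finite ((\<lambda>u. X u \<omega>) ` {0..t})" by (rule step_path_finite_range)
      then obtain m where m: "\<And>u. u \<in> {0..t} \<Longrightarrow> X u \<omega> \<le> m"
        unfolding finite_nat_set_iff_bounded_le by blast
      have "real k * (t / real n) \<in> {0..t}" if "k \<le> n" for k n
        using mult_right_mono[of "real k / real n" 1 t] that t by (simp add: divide_le_eq)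
      then show ?thesis using m \<omega> by (auto simp: R_def)
    qed
    then show ?thesis by (auto simp: R_def)
  qed
  have R_lim: "(\<lambda>m. prob (R m)) \<longlonglongrightarrow> 1"
  proof -
    have "(\<lambda>m. prob (R m)) \<longlonglongrightarrow> prob (\<Union>m. R m)"
    proof (rule finite_Lim_measure_incseq)
      show "incseq R"
        unfolding R_def by (rule incseq_SucI) (auto intro: le_SucI)
    qed (use R_sets in blast)
    then show ?thesis by (simp add: R_UN prob_space)
  qed
  define E where "E = {\<omega> \<in> space M. X t \<omega> \<notin> S}"
  define Z where "Z = {\<omega> \<in> space M. X 0 \<omega> \<noteq> i0}"
  have Z: "Z \<in> events" "prob Z = 0"
  proof -
    show "Z \<in> events" by (simp add: Z_def X_sets)
    have "prob {\<omega> \<in> space M. X 0 \<omega> = i0} = 1" using ctmc by (auto simp: ctmc_def M_def)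
    moreover have "Z = space M - {\<omega> \<in> space M. X 0 \<omega> = i0}" by (auto simp: Z_def)
    ultimately show "prob Z = 0"
      using prob_compl[of "{\<omega> \<in> space M. X 0 \<omega> = i0}"] X_sets[of 0 "\<lambda>x. x = i0"] by simp
  qed
  have bound: "prob E \<le> (1 - prob (R m)) + (\<Sum>i\<in>S \<inter> {..m}. real n * esc g i (t / real n))"
    if n: "0 < n" for m n g
  proof -
    define B where "B i k = {\<omega> \<in> space M. X (real k * (t / real n)) \<omega> = i \<and>
        X (real k * (t / real n) + t / real n) \<omega> \<notin> S}" for i k
    have B_sets: "B i k \<in> events" for i k
      unfolding B_def using t by (intro X2_sets) auto
    have UB1_sets: "(\<Union>k<n. B i k) \<in> events" for i
      by (intro sets.finite_UN B_sets) auto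
    have UB_sets: "(\<Union>i\<in>S \<inter> {..m}. \<Union>k<n. B i k) \<in> events"
      by (intro sets.finite_UN B_sets) auto
    have B_prob: "prob (B i k) \<le> esc g i (t / real n)" for i k
      unfolding B_def using t n by (intro leave) auto
    have "E \<subseteq> Z \<union> ((space M - R m) \<union> (\<Union>i\<in>S \<inter> {..m}. \<Union>k<n. B i k))"
    proof
      fix \<omega> assume \<omega>: "\<omega> \<in> E"
      show "\<omega> \<in> Z \<union> ((space M - R m) \<union> (\<Union>i\<in>S \<inter> {..m}. \<Union>k<n. B i k))"
      proof (cases "\<omega> \<in> Z \<or> \<omega> \<notin> R m")
        case True
        then show ?thesis using \<omega> by (auto simp: E_def)
      next
        case False
        define x where "x k = X (real k * (t / real n)) \<omega>" for k
        have "x 0 \<in> S" using False \<omega> i0 by (auto simp: Z_def E_def x_def)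
        moreover have "x n \<notin> S" using \<omega> n by (auto simp: E_def x_def)
        ultimately have "\<exists>k<n. x k \<in> S \<and> x (Suc k) \<notin> S"
          using dec_induct[of 0 n "\<lambda>k. x k \<in> S"] by blast
        then obtain k where k: "k < n" "x k \<in> S" "x (Suc k) \<notin> S" by blast
        moreover have "x k \<le> m" using False k by (auto simp: R_def x_def)
        moreover have "\<omega> \<in> B (x k) k" using k \<omega> by (auto simp: B_def x_def E_def algebra_simps add_divide_distrib)
        ultimately show ?thesis by blast
      qed
    qed
    then have "prob E \<le> prob (Z \<union> ((space M - R m) \<union> (\<Union>i\<in>S \<inter> {..m}. \<Union>k<n. B i k)))"
      by (intro finite_measure_mono sets.Un sets.compl_sets Z R_sets UB_sets)
    also have "\<dots> \<le> prob Z + prob ((space M - R m) \<union> (\<Union>i\<in>S \<inter> {..m}. \<Union>k<n. B i k))"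
      by (intro measure_Un_le sets.Un sets.compl_sets Z R_sets UB_sets)
    also have "prob ((space M - R m) \<union> (\<Union>i\<in>S \<inter> {..m}. \<Union>k<n. B i k)) \<le>
       prob (space M - R m) + prob (\<Union>i\<in>S \<inter> {..m}. \<Union>k<n. B i k)"
      by (intro measure_Un_le sets.compl_sets R_sets UB_sets)
    also have "prob (\<Union>i\<in>S \<inter> {..m}. \<Union>k<n. B i k) \<le> (\<Sum>i\<in>S \<inter> {..m}. prob (\<Union>k<n. B i k))"
      using UB1_sets by (intro finite_measure_subadditive_finite) auto
    also have "\<dots> \<le> (\<Sum>i\<in>S \<inter> {..m}. \<Sum>k<n. prob (B i k))"
      using B_sets by (intro sum_mono finite_measure_subadditive_finite) auto
    also have "\<dots> \<le> (\<Sum>i\<in>S \<inter> {..m}. \<Sum>k<n. esc g i (t / real n))"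
      by (intro sum_mono B_prob)
    finally show ?thesis using Z prob_compl[OF R_sets[of m]] by simp
  qed
  \<comment> \<open>The order of limits matters: the grid is refined for fixed \<open>m\<close> and
    \<open>g\<close>, then \<open>g\<close> grows and the row sums vanish, and only then does
    \<open>m\<close> grow to capture almost every path.\<close>
  have bound2: "prob E \<le> (1 - prob (R m)) + (\<Sum>i\<in>S \<inter> {..m}. t * - (\<Sum>j\<le>g. q i j))"
    if "m \<le> g" for m g
  proof (rule tendsto_lowerbound)
    have *: "filterlim (\<lambda>n. t / real n) (at_right 0) sequentially"
      using t by real_asymp
    have "(\<lambda>n. t * (esc g i (t / real n) / (t / real n))) \<longlonglongrightarrow> t * - (\<Sum>j\<le>g. q i j)" if "i \<in> S \<inter> {..m}" for i
      by (intro tendsto_mult tendsto_const filterlim_compose[OF esc_lim *]) (use that \<open>m \<le> g\<close> in auto)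
    then show "(\<lambda>n. (1 - prob (R m)) + (\<Sum>i\<in>S \<inter> {..m}. t * (esc g i (t / real n) / (t / real n))))
      \<longlonglongrightarrow> (1 - prob (R m)) + (\<Sum>i\<in>S \<inter> {..m}. t * - (\<Sum>j\<le>g. q i j))"
      by (intro tendsto_add tendsto_const tendsto_sum)
    show "\<forall>\<^sub>F n in sequentially. prob E \<le> (1 - prob (R m)) + (\<Sum>i\<in>S \<inter> {..m}. t * (esc g i (t / real n) / (t / real n)))"
      using eventually_gt_at_top[of 0]
    proof eventually_elim
      case (elim n)
      have "t * (esc g i (t / real n) / (t / real n)) = real n * esc g i (t / real n)" for i
        using t elim by simp
      then show ?case using bound[OF elim, of m g] by simp
    qed
  qed auto
  have "prob E \<le> 1 - prob (R m)" for m
  proof (rule tendsto_lowerbound)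
    have "(\<lambda>g. \<Sum>j\<le>g. q i j) \<longlonglongrightarrow> 0" for i
      using cons by (auto simp: conservative_Q_matrix_def sums_def_le)
    then have "(\<lambda>g. (1 - prob (R m)) + (\<Sum>i\<in>S \<inter> {..m}. t * - (\<Sum>j\<le>g. q i j))) \<longlonglongrightarrow>
       (1 - prob (R m)) + (\<Sum>i\<in>S \<inter> {..m}. t * - 0)"
      by (intro tendsto_intros)
    then show "(\<lambda>g. (1 - prob (R m)) + (\<Sum>i\<in>S \<inter> {..m}. t * - (\<Sum>j\<le>g. q i j))) \<longlonglongrightarrow> 1 - prob (R m)"
      by simp
    show "\<forall>\<^sub>F g in sequentially. prob E \<le> (1 - prob (R m)) + (\<Sum>i\<in>S \<inter> {..m}. t * - (\<Sum>j\<le>g. q i j))"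
      using eventually_ge_at_top[of m] by eventually_elim (rule bound2)
  qed auto
  moreover have "(\<lambda>m. 1 - prob (R m)) \<longlonglongrightarrow> 1 - 1"
    by (intro tendsto_intros R_lim)
  ultimately have "prob E \<le> 1 - 1"
    by (intro tendsto_lowerbound[of "\<lambda>m. 1 - prob (R m)" _ sequentially]) auto
  then show ?thesis by (simp add: E_def M_def measure_le_0_iff)
qed

text \<open>A state outside a closed set would be reached from inside with probability zero at every
  positive time, against irreducibility of the transition probabilities.\<close>

lemma ergodic_generator_irreducible:
  assumes "ergodic_generator q"
  shows "Q_irreducible q"
  unfolding Q_irreducible_def
proof (intro allI impI)
  fix S assume S: "closed_states q S" "S \<noteq> {}"
  obtain P :: "nat \<Rightarrow> (real \<Rightarrow> nat) measure" and X where
    PX: "ctmc P X" "ctmc_irreducible P X" "ctmc_generator P X q" and cons: "conservative_Q_matrix q"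
    using assms unfolding ergodic_generator_def by blast
  obtain i where i: "i \<in> S" using S by blast
  have "j \<in> S" for j
  proof (rule ccontr)
    assume j: "j \<notin> S"
    obtain t where t: "t > 0" "trans_prob P X t i j > 0"
      using PX(2) unfolding ctmc_irreducible_def by blast
    interpret prob_space "P i" using PX(1) unfolding ctmc_def by blast
    have "X t \<in> measurable (P i) (count_space UNIV)" using PX(1) t unfolding ctmc_def by auto
    from measurable_sets[OF this, of "- S"]
    have "{\<omega> \<in> space (P i). X t \<omega> \<notin> S} \<in> events"
      by (simp add: vimage_def Int_def conj_commute)
    then have "trans_prob P X t i j \<le> prob {\<omega> \<in> space (P i). X t \<omega> \<notin> S}"
      unfolding trans_prob_def by (intro finite_measure_mono) (use j in auto)
    with ctmc_exit_measure_zero[OF PX(1) PX(3) cons S(1) i t(1)] t(2) show False by simp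
  qed
  then show "S = UNIV" by blast
qed

section \<open>Invariant measures\<close>

text \<open>Fubini for absolutely summable double series, by way of unconditional sums over pairs.
  Column summability is a separate conclusion because \<open>suminf\<close> says nothing without
  it.\<close>

lemma suminf_swap_sums:
  fixes a :: "nat \<Rightarrow> nat \<Rightarrow> real"
  assumes row: "\<And>i. summable (\<lambda>j. \<bar>a i j\<bar>)" and tot: "summable (\<lambda>i. \<Sum>j. \<bar>a i j\<bar>)"
  shows "(\<lambda>j. \<Sum>i. a i j) sums (\<Sum>i. \<Sum>j. a i j)"
    and "(\<lambda>i. \<Sum>j. a i j) sums (\<Sum>i. \<Sum>j. a i j)"
    and "summable (\<lambda>i. \<bar>a i j\<bar>)"
proof -
  define f where "f = (\<lambda>(i, j). a i j)"
  have row': "((\<lambda>j. \<bar>a i j\<bar>) has_sum (\<Sum>j. \<bar>a i j\<bar>)) UNIV" for i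
    using row[of i] by (intro norm_summable_imp_has_sum summable_sums) auto
  have "(\<lambda>z. \<bar>f z\<bar>) summable_on UNIV \<times> UNIV"
    by (rule summable_on_SigmaI[where g = "\<lambda>i. \<Sum>j. \<bar>a i j\<bar>"])
      (use row' tot row in \<open>auto simp: f_def summable_on_UNIV_nonneg_real_iff suminf_nonneg\<close>)
  then have f: "f summable_on UNIV \<times> UNIV"
    using summable_on_iff_abs_summable_on_real[of f] by simp
  then obtain S where S: "(f has_sum S) (UNIV \<times> UNIV)" by (auto simp: summable_on_def)
  have r: "((\<lambda>j. f (i, j)) has_sum (\<Sum>j. a i j)) UNIV" for i
    using row[of i] unfolding f_def
    by (auto intro!: norm_summable_imp_has_sum intro: summable_rabs_cancel)
  have row_sum: "((\<lambda>i. \<Sum>j. a i j) has_sum S) UNIV"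
    by (rule has_sum_SigmaD[OF S]) (use r in auto)
  note row_sums = has_sum_imp_sums[OF row_sum]
  have S_eq: "S = (\<Sum>i. \<Sum>j. a i j)"
    by (rule sums_unique[OF row_sums])
  show "(\<lambda>i. \<Sum>j. a i j) sums (\<Sum>i. \<Sum>j. a i j)"
    using row_sums by (simp add: S_eq)
  have f': "((\<lambda>(j, i). a i j) has_sum S) (UNIV \<times> UNIV)"
    using S has_sum_swap[where f = f and S = S and A = UNIV and B = UNIV] by (simp add: f_def)
  have col: "(\<lambda>i. a i j) summable_on UNIV" for j
    using summable_on_SigmaD1[of "\<lambda>j i. a i j" UNIV "\<lambda>_. UNIV" j] f' by (auto simp: summable_on_def)
  then show "summable (\<lambda>i. \<bar>a i j\<bar>)" for j
    using summable_on_iff_abs_summable_on_real[of "\<lambda>i. a i j" UNIV] summable_on_imp_summable by simp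
  have c: "((\<lambda>i. a i j) has_sum (\<Sum>i. a i j)) UNIV" for j
  proof -
    obtain x where x: "((\<lambda>i. a i j) has_sum x) UNIV" using col[of j] by (auto simp: summable_on_def)
    then have "x = (\<Sum>i. a i j)" by (intro sums_unique has_sum_imp_sums)
    with x show ?thesis by simp
  qed
  have "((\<lambda>j. \<Sum>i. a i j) has_sum S) UNIV"
    by (rule has_sum_SigmaD[OF f']) (use c in auto)
  then show "(\<lambda>j. \<Sum>i. a i j) sums (\<Sum>i. \<Sum>j. a i j)"
    unfolding S_eq[symmetric] by (rule has_sum_imp_sums)
qed

section \<open>Conservative rate matrices, test functions and invariance\<close>

context
  fixes q :: "nat \<Rightarrow> nat \<Rightarrow> real"
  assumes cons: "conservative_Q_matrix q"
begin

lemma Q_neg: "q i i < 0" and Q_nonneg: "i \<noteq> j \<Longrightarrow> 0 \<le> q i j" and Q_row: "(\<lambda>j. q i j) sums 0"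
  using cons unfolding conservative_Q_matrix_def by auto

text \<open>Only the diagonal entry of a row is negative; flipping its sign adds
  \<open>2 * \<bar>q i i\<bar>\<close> to a sum that is zero.\<close>

lemma Q_abs_row: "(\<lambda>j. \<bar>q i j\<bar>) sums (2 * \<bar>q i i\<bar>)"
proof -
  have "(\<lambda>j. q i j - 2 * (if j = i then q i i else 0)) sums (0 - 2 * q i i)"
    by (intro sums_diff Q_row sums_mult sums_single)
  moreover have "(\<lambda>j. q i j - 2 * (if j = i then q i i else 0)) = (\<lambda>j. \<bar>q i j\<bar>)"
    using Q_neg[of i] Q_nonneg[of i] by (auto simp: fun_eq_iff)
  ultimately show ?thesis using Q_neg[of i] by simp
qed

lemma Q_abs_summable_mult:
  assumes "summable (\<lambda>j. q i j * v j)" and nonneg: "\<And>j. 0 \<le> v j"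
  shows "summable (\<lambda>j. \<bar>q i j * v j\<bar>)"
proof -
  have "summable (\<lambda>j. q i j * v j - 2 * (if j = i then q i i * v i else 0))"
    by (intro summable_diff assms(1) summable_mult sums_summable[OF sums_single])
  moreover have "(\<lambda>j. q i j * v j - 2 * (if j = i then q i i * v i else 0)) = (\<lambda>j. \<bar>q i j * v j\<bar>)"
    using Q_neg[of i] Q_nonneg[of i] nonneg by (auto simp: fun_eq_iff abs_mult)
  ultimately show ?thesis by simp
qed

lemma Q_bounded_mult:
  assumes "\<And>j. \<bar>f j\<bar> \<le> B"
  shows "summable (\<lambda>j. \<bar>q i j * f j\<bar>)" "(\<Sum>j. \<bar>q i j * f j\<bar>) \<le> 2 * \<bar>q i i\<bar> * B"
proof -
  have *: "(\<lambda>j. \<bar>q i j\<bar> * B) sums (2 * \<bar>q i i\<bar> * B)"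
    by (intro sums_mult2 Q_abs_row)
  have le: "\<bar>q i j * f j\<bar> \<le> \<bar>q i j\<bar> * B" for j
    by (simp add: abs_mult assms mult_left_mono)
  show "summable (\<lambda>j. \<bar>q i j * f j\<bar>)"
    by (rule summable_comparison_test'[OF sums_summable[OF *]]) (use le in auto)
  from suminf_le[OF le this sums_summable[OF *]] sums_unique[OF *]
  show "(\<Sum>j. \<bar>q i j * f j\<bar>) \<le> 2 * \<bar>q i i\<bar> * B" by simp
qed

text \<open>Row \<open>i\<close> of \<open>q i j * f j\<close> has absolute mass at most
  \<open>2 * \<bar>q i i\<bar> * B\<close>, so a finite mean jump rate makes the double series
  absolutely convergent and Fubini applies.\<close>

lemma Q_test_function:
  assumes \<mu>: "\<And>i. 0 \<le> \<mu> i" and s: "summable (\<lambda>i. \<mu> i * \<bar>q i i\<bar>)" and f: "\<And>j. \<bar>f j\<bar> \<le> B"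
  shows "(\<lambda>j. f j * (\<Sum>i. \<mu> i * q i j)) sums (\<Sum>i. \<mu> i * (\<Sum>j. q i j * f j))"
    and "(\<lambda>i. \<mu> i * (\<Sum>j. q i j * f j)) sums (\<Sum>i. \<mu> i * (\<Sum>j. q i j * f j))"
proof -
  define a where "a i j = \<mu> i * (q i j * f j)" for i j
  have abs_a: "\<bar>a i j\<bar> = \<mu> i * \<bar>q i j * f j\<bar>" for i j
    using \<mu>[of i] by (simp add: a_def abs_mult)
  have row: "summable (\<lambda>j. \<bar>a i j\<bar>)" for i
    unfolding abs_a by (intro summable_mult Q_bounded_mult[OF f])
  have "norm (\<Sum>j. \<bar>a i j\<bar>) \<le> \<mu> i * \<bar>q i i\<bar> * (2 * B)" for i
  proof -
    have "(\<Sum>j. \<bar>a i j\<bar>) = \<mu> i * (\<Sum>j. \<bar>q i j * f j\<bar>)"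
      unfolding abs_a by (rule suminf_mult[OF Q_bounded_mult(1)[OF f]])
    also have "\<dots> \<le> \<mu> i * (2 * \<bar>q i i\<bar> * B)"
      by (intro mult_left_mono \<mu> Q_bounded_mult[OF f])
    finally show ?thesis using suminf_nonneg[OF row[of i]] by (simp add: mult_ac)
  qed
  then have tot: "summable (\<lambda>i. \<Sum>j. \<bar>a i j\<bar>)"
    by (intro summable_comparison_test'[OF summable_mult2[OF s]]) auto
  have r: "(\<Sum>j. a i j) = \<mu> i * (\<Sum>j. q i j * f j)" for i
    unfolding a_def by (rule suminf_mult[OF summable_rabs_cancel[OF Q_bounded_mult(1)[OF f]]])
  \<comment> \<open>Summability of \<open>\<mu> i * q i j\<close> over \<open>i\<close> is recovered
    from \<open>a\<close> by dividing by \<open>f j\<close>; where \<open>f j = 0\<close>, both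
    sides are zero whatever \<open>suminf\<close> returns.\<close>
  have c: "(\<Sum>i. a i j) = f j * (\<Sum>i. \<mu> i * q i j)" for j
  proof (cases "f j = 0")
    case False
    have "summable (\<lambda>i. a i j)"
      by (rule summable_rabs_cancel[OF suminf_swap_sums(3)[OF row tot]])
    from summable_mult[OF this, of "1 / f j"]
    have *: "summable (\<lambda>i. \<mu> i * q i j)" using False by (simp add: a_def)
    show ?thesis using suminf_mult[OF *, of "f j"] by (simp add: a_def mult_ac)
  qed (simp add: a_def)
  show "(\<lambda>j. f j * (\<Sum>i. \<mu> i * q i j)) sums (\<Sum>i. \<mu> i * (\<Sum>j. q i j * f j))"
    using suminf_swap_sums(1)[OF row tot] by (simp add: r c)
  show "(\<lambda>i. \<mu> i * (\<Sum>j. q i j * f j)) sums (\<Sum>i. \<mu> i * (\<Sum>j. q i j * f j))"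
    using suminf_swap_sums(2)[OF row tot] by (simp add: r)
qed

lemma invariant_test_function:
  assumes "\<And>i. 0 \<le> \<mu> i" "summable (\<lambda>i. \<mu> i * \<bar>q i i\<bar>)" "\<And>j. \<bar>f j\<bar> \<le> B"
    and "\<And>j. (\<lambda>i. \<mu> i * q i j) sums 0"
  shows "(\<lambda>i. \<mu> i * (\<Sum>j. q i j * f j)) sums 0"
proof -
  have "(\<Sum>i. \<mu> i * q i j) = 0" for j by (rule sums_unique[OF assms(4), symmetric])
  then have "(\<Sum>i. \<mu> i * (\<Sum>j. q i j * f j)) = 0"
    using Q_test_function(1)[of \<mu> f B] assms sums_unique2[OF _ sums_zero] by simp
  then show ?thesis using Q_test_function(2)[of \<mu> f B] assms by simp
qed

lemma Q_col_summable:
  assumes "\<And>i. 0 \<le> \<mu> i" "summable (\<lambda>i. \<mu> i * \<bar>q i i\<bar>)"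
  shows "summable (\<lambda>i. \<mu> i * q i j)"
proof (rule summable_comparison_test'[OF assms(2)])
  fix i
  have "\<bar>q i j\<bar> \<le> \<bar>q i i\<bar>"
  proof (cases "i = j")
    case False
    have "(\<Sum>k\<in>{i, j}. \<bar>q i k\<bar>) \<le> 2 * \<bar>q i i\<bar>"
      using sum_le_suminf[OF sums_summable[OF Q_abs_row], of "{i, j}" i] sums_unique[OF Q_abs_row[of i]]
      by simp
    then show ?thesis using False by simp
  qed simp
  then show "norm (\<mu> i * q i j) \<le> \<mu> i * \<bar>q i i\<bar>"
    using assms(1)[of i] by (simp add: abs_mult mult_left_mono)
qed

text \<open>Pairing with the constant function \<open>1\<close> makes the column deficits sum to
  zero; being of one sign, they all vanish.\<close>

lemma subinvariant_imp_invariant: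
  assumes \<mu>: "\<And>i. 0 \<le> \<mu> i" "summable (\<lambda>i. \<mu> i * \<bar>q i i\<bar>)"
    and sub: "\<And>j. (\<Sum>i. \<mu> i * q i j) \<le> 0"
  shows "(\<lambda>i. \<mu> i * q i j) sums 0"
proof -
  have "(\<Sum>j. q i j * 1) = 0" for i using Q_row[of i] sums_unique by force
  then have "(\<lambda>j. (\<Sum>i. \<mu> i * q i j)) sums 0"
    using Q_test_function(1)[OF \<mu>, of "\<lambda>_. 1" 1] by simp
  then have *: "(\<lambda>j. - (\<Sum>i. \<mu> i * q i j)) sums 0"
    using sums_minus by force
  have "- (\<Sum>i. \<mu> i * q i j) = 0"
    using suminf_eq_zero_iff[OF sums_summable[OF *]] sub sums_unique[OF *] by simp
  then show ?thesis using summable_sums[OF Q_col_summable[OF \<mu>, of j]] by simp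
qed

text \<open>The support of \<open>d\<close> is closed: at a state without mass the diagonal term
  drops out, so the nonnegative inflows sum to zero.\<close>

lemma invariant_zero:
  assumes irr: "Q_irreducible q" and d: "\<And>i. 0 \<le> d i" and inv: "\<And>j. (\<lambda>i. d i * q i j) sums 0"
    and z: "d i0 = 0"
  shows "d i = 0"
proof -
  have "closed_states q {i. d i \<noteq> 0}"
    unfolding closed_states_def
  proof (intro ballI allI impI)
    fix i j assume "i \<in> {i. d i \<noteq> 0}" "j \<notin> {i. d i \<noteq> 0}"
    then have ij: "d i \<noteq> 0" "d j = 0" by auto
    have "0 \<le> d i * q i j" for i using d ij Q_nonneg[of i j] by (cases "i = j") auto
    then have "d i * q i j = 0"
      using suminf_eq_zero_iff[OF sums_summable[OF inv[of j]]] sums_unique[OF inv[of j]] by auto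
    then show "q i j = 0" using ij by simp
  qed
  then have "{i. d i \<noteq> 0} = {} \<or> {i. d i \<noteq> 0} = UNIV"
    using irr unfolding Q_irreducible_def by blast
  then show ?thesis using z by blast
qed

text \<open>With \<open>K = \<nu> k / \<mu> k\<close> the measure \<open>min \<nu> (K \<mu>)\<close> is subinvariant and has finite jump rate,
  hence is invariant; its difference to \<open>K \<mu>\<close> is invariant and vanishes at \<open>k\<close>.\<close>

lemma invariant_measure_unique:
  assumes irr: "Q_irreducible q"
    and \<mu>: "\<And>i. 0 < \<mu> i" "summable (\<lambda>i. \<mu> i * \<bar>q i i\<bar>)" "\<And>j. (\<lambda>i. \<mu> i * q i j) sums 0"
    and \<nu>: "\<And>i. 0 \<le> \<nu> i" "\<And>j. (\<lambda>i. \<nu> i * q i j) sums 0"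
  shows "\<nu> i * \<mu> k = \<nu> k * \<mu> i"
proof -
  have "\<nu> k * \<mu> i \<le> \<nu> i * \<mu> k" for i k
  proof -
    define K where "K = \<nu> k / \<mu> k"
    have K: "0 \<le> K" using \<mu>(1)[of k] \<nu>(1)[of k] by (simp add: K_def)
    define \<rho> where "\<rho> i = min (\<nu> i) (K * \<mu> i)" for i
    have \<rho>0: "0 \<le> \<rho> i" for i using \<nu>(1)[of i] \<mu>(1)[of i] K by (simp add: \<rho>_def)
    have K\<mu>: "(\<lambda>i. K * \<mu> i * q i j) sums 0" for j
      using sums_mult[OF \<mu>(3)[of j], of K] by (simp add: mult_ac)
    have \<rho>s: "summable (\<lambda>i. \<rho> i * \<bar>q i i\<bar>)"
    proof (rule summable_comparison_test'[OF summable_mult[OF \<mu>(2), of K]])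
      fix i
      have "\<rho> i * \<bar>q i i\<bar> \<le> K * \<mu> i * \<bar>q i i\<bar>"
        by (intro mult_right_mono) (auto simp: \<rho>_def)
      then show "norm (\<rho> i * \<bar>q i i\<bar>) \<le> K * (\<mu> i * \<bar>q i i\<bar>)"
        using \<rho>0[of i] by (simp add: abs_mult mult_ac)
    qed
    have "(\<Sum>i. \<rho> i * q i j) \<le> 0" for j
    proof -
      \<comment> \<open>Take for \<open>\<sigma>\<close> whichever of \<open>\<nu>\<close> and
        \<open>K * \<mu>\<close> attains the minimum at \<open>j\<close>. It agrees with
        \<open>\<rho>\<close> there and dominates it elsewhere, where the rates into
        \<open>j\<close> are nonnegative, so its vanishing column sum bounds that of
        \<open>\<rho>\<close>.\<close>
      have "\<exists>\<sigma>. (\<forall>i. \<rho> i \<le> \<sigma> i) \<and> \<rho> j = \<sigma> j \<and> (\<lambda>i. \<sigma> i * q i j) sums 0"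
        using \<nu>(2)[of j] K\<mu>[of j] by (cases "\<nu> j \<le> K * \<mu> j")
          (auto simp: \<rho>_def intro: exI[of _ \<nu>] exI[of _ "\<lambda>i. K * \<mu> i"])
      then obtain \<sigma> where \<sigma>: "\<And>i. \<rho> i \<le> \<sigma> i" "\<rho> j = \<sigma> j" "(\<lambda>i. \<sigma> i * q i j) sums 0" by blast
      have "\<rho> i * q i j \<le> \<sigma> i * q i j" for i
        using \<sigma>(1)[of i] \<sigma>(2) Q_nonneg[of i j] by (cases "i = j") (auto intro: mult_right_mono)
      from suminf_le[OF this Q_col_summable[OF \<rho>0 \<rho>s] sums_summable[OF \<sigma>(3)]]
      show ?thesis using sums_unique[OF \<sigma>(3)] by simp
    qed
    note \<rho>_inv = subinvariant_imp_invariant[OF \<rho>0 \<rho>s this]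
    have "K * \<mu> i - \<rho> i = 0" for i
    proof (rule invariant_zero[OF irr, where d = "\<lambda>i. K * \<mu> i - \<rho> i"])
      show "(\<lambda>i. (K * \<mu> i - \<rho> i) * q i j) sums 0" for j
        using sums_diff[OF K\<mu> \<rho>_inv, of j] by (simp add: algebra_simps)
      show "K * \<mu> k - \<rho> k = 0" using \<mu>(1)[of k] by (simp add: \<rho>_def K_def)
    qed (simp add: \<rho>_def)
    from this[of i] have "K * \<mu> i \<le> \<nu> i" by (simp add: \<rho>_def)
    then show ?thesis using \<mu>(1)[of k] by (simp add: K_def field_simps)
  qed
  from this[of i k] this[of k i] show ?thesis by (simp add: mult.commute)
qed

end

section \<open>Limits of probability vectors under a drift condition\<close>

lemma suminf_dominated_limit:
  fixes a :: "nat \<Rightarrow> nat \<Rightarrow> real"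
  assumes "\<And>k. (\<lambda>n. a n k) \<longlonglongrightarrow> b k" "\<And>n k. \<bar>a n k\<bar> \<le> M k" "summable M"
  shows "(\<lambda>n. \<Sum>k. a n k) \<longlonglongrightarrow> (\<Sum>k. b k)"
proof -
  have "\<forall>\<^sub>F (k, n) in at_top \<times>\<^sub>F sequentially. norm (a n k) \<le> M k"
    using assms(2) by (intro always_eventually) auto
  then show ?thesis
    using tannerys_theorem[of "\<lambda>k n. a n k" b sequentially M] assms(1,3) by simp
qed

text \<open>For bounded \<open>f\<close> the \<open>\<mu>\<close>-mean of \<open>Q f\<close> vanishes. With \<open>f = min v n\<close>, the function \<open>\<bar>Q f\<bar>\<close> is
  at most \<open>U + D\<close>, the mean upward plus the mean downward drift of \<open>v\<close>; since \<open>D = U - Q v\<close>, the bound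
  on upward drift outside \<open>C\<close> makes this integrable, and \<open>n\<close> can tend to infinity.\<close>

lemma truncated_drift_limit:
  fixes q :: "nat \<Rightarrow> nat \<Rightarrow> real" and v \<mu> :: "nat \<Rightarrow> real"
  assumes cons: "conservative_Q_matrix q"
    and \<mu>: "\<And>i. 0 \<le> \<mu> i" "summable (\<lambda>i. \<mu> i * (\<bar>q i i\<bar> + 1))" "\<And>j. (\<lambda>i. \<mu> i * q i j) sums 0"
    and v: "\<And>i. 0 \<le> v i" and qv: "\<And>i. summable (\<lambda>j. q i j * v j)"
    and zs: "summable (\<lambda>i. \<mu> i * (\<Sum>j. q i j * v j))"
    and C: "finite C"
    and up: "\<And>i F. i \<notin> C \<Longrightarrow> finite F \<Longrightarrow> F \<subseteq> - C \<Longrightarrow>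
       (\<Sum>j\<in>F. q i j * max (v j - v i) 0) \<le> M * (\<bar>q i i\<bar> + 1)"
  shows "(\<Sum>i. \<mu> i * (\<Sum>j. q i j * v j)) = 0"
proof -
  define z where "z i = (\<Sum>j. q i j * v j)" for i
  note neg = Q_neg[OF cons] and nonneg = Q_nonneg[OF cons]
  have qv_abs: "summable (\<lambda>j. \<bar>q i j * v j\<bar>)" for i
    by (rule Q_abs_summable_mult[OF cons qv v])
  \<comment> \<open>Subtracting the vanishing row sum turns Q v into a sum of increments, ready to
    be split into upward and downward parts.\<close>
  have q_sums: "(\<lambda>j. q i j * (v j - v i)) sums z i" for i
  proof -
    have "(\<lambda>j. q i j * v j - q i j * v i) sums (z i - 0 * v i)"
      unfolding z_def by (intro sums_diff summable_sums qv sums_mult2 Q_row[OF cons])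
    then show ?thesis by (simp add: right_diff_distrib)
  qed
  have dom: "summable (\<lambda>j. \<bar>q i j * v j\<bar> + \<bar>q i j\<bar> * v i)" for i
    by (intro summable_add qv_abs summable_mult2 sums_summable[OF Q_abs_row[OF cons]])
  define U where "U i = (\<Sum>j. q i j * max (v j - v i) 0)" for i
  define D where "D i = (\<Sum>j. q i j * max (v i - v j) 0)" for i
  have up_nonneg: "0 \<le> q i j * max (v j - v i) 0" for i j
    using nonneg[of i j] by (cases "i = j") auto
  have down_nonneg: "0 \<le> q i j * max (v i - v j) 0" for i j
    using nonneg[of i j] by (cases "i = j") auto
  have U_summable: "summable (\<lambda>j. q i j * max (v j - v i) 0)" for i
  proof (rule summable_comparison_test'[OF dom])
    fix j
    have "\<bar>q i j\<bar> * \<bar>max (v j - v i) 0\<bar> \<le> \<bar>q i j\<bar> * (v j + v i)"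
      using v[of i] v[of j] by (intro mult_left_mono) auto
    then show "norm (q i j * max (v j - v i) 0) \<le> \<bar>q i j * v j\<bar> + \<bar>q i j\<bar> * v i"
      using v[of j] by (simp add: abs_mult distrib_left)
  qed
  have D_summable: "summable (\<lambda>j. q i j * max (v i - v j) 0)" for i
  proof (rule summable_comparison_test'[OF dom])
    fix j
    have "\<bar>q i j\<bar> * \<bar>max (v i - v j) 0\<bar> \<le> \<bar>q i j\<bar> * (v j + v i)"
      using v[of i] v[of j] by (intro mult_left_mono) auto
    then show "norm (q i j * max (v i - v j) 0) \<le> \<bar>q i j * v j\<bar> + \<bar>q i j\<bar> * v i"
      using v[of j] by (simp add: abs_mult distrib_left)
  qed
  have U0: "0 \<le> U i" and D0: "0 \<le> D i" for i
    unfolding U_def D_def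
    by (intro suminf_nonneg U_summable D_summable up_nonneg down_nonneg)+
  have UD: "U i - D i = z i" for i
  proof -
    have "U i - D i = (\<Sum>j. q i j * max (v j - v i) 0 - q i j * max (v i - v j) 0)"
      unfolding U_def D_def by (rule suminf_diff[OF U_summable D_summable])
    also have "\<dots> = (\<Sum>j. q i j * (v j - v i))"
      by (intro suminf_cong) (simp add: max_def algebra_simps)
    finally show ?thesis using sums_unique[OF q_sums] by simp
  qed
  \<comment> \<open>The hypothesis \<open>up\<close> sees only jumps inside the complement of
    \<open>C\<close>. A jump into \<open>C\<close> rises by at most \<open>vC\<close>, and the rates
    of a row have absolute sum \<open>2 * \<bar>q i i\<bar>\<close>; hence the constant
    \<open>M + 2 * vC\<close>.\<close>
  define vC where "vC = (\<Sum>i\<in>C. v i)"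
  have vC: "v j \<le> vC" if "j \<in> C" for j
    unfolding vC_def using member_le_sum[of j C v] that v C by auto
  have vC0: "0 \<le> vC" by (simp add: vC_def v sum_nonneg)
  have U_le: "U i \<le> (M + 2 * vC) * (\<bar>q i i\<bar> + 1)" if "i \<notin> C" for i
    unfolding U_def
  proof (rule suminf_le_const[OF U_summable])
    fix n
    have "(\<Sum>j<n. q i j * max (v j - v i) 0) =
       (\<Sum>j\<in>{..<n} - C. q i j * max (v j - v i) 0) + (\<Sum>j\<in>{..<n} \<inter> C. q i j * max (v j - v i) 0)"
      by (subst add.commute, rule sum.Int_Diff) simp
    also have "(\<Sum>j\<in>{..<n} - C. q i j * max (v j - v i) 0) \<le> M * (\<bar>q i i\<bar> + 1)"
      by (rule up[OF that]) auto
    also have "(\<Sum>j\<in>{..<n} \<inter> C. q i j * max (v j - v i) 0) \<le> (\<Sum>j\<in>{..<n} \<inter> C. \<bar>q i j\<bar> * vC)"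
    proof (rule sum_mono)
      fix j assume "j \<in> {..<n} \<inter> C"
      then have "\<bar>q i j\<bar> * max (v j - v i) 0 \<le> \<bar>q i j\<bar> * vC"
        using vC[of j] v[of i] vC0 by (intro mult_left_mono) auto
      moreover have "q i j * max (v j - v i) 0 \<le> \<bar>q i j\<bar> * max (v j - v i) 0"
        by (intro mult_right_mono) auto
      ultimately show "q i j * max (v j - v i) 0 \<le> \<bar>q i j\<bar> * vC" by linarith
    qed
    also have "\<dots> = (\<Sum>j\<in>{..<n} \<inter> C. \<bar>q i j\<bar>) * vC" by (simp add: sum_distrib_right)
    also have "(\<Sum>j\<in>{..<n} \<inter> C. \<bar>q i j\<bar>) \<le> 2 * \<bar>q i i\<bar>"
      using sum_le_suminf[OF sums_summable[OF Q_abs_row[OF cons]], of "{..<n} \<inter> C" i]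
        sums_unique[OF Q_abs_row[OF cons, of i]] by simp
    then have "(\<Sum>j\<in>{..<n} \<inter> C. \<bar>q i j\<bar>) * vC \<le> 2 * \<bar>q i i\<bar> * vC"
      by (rule mult_right_mono[OF _ vC0])
    finally show "(\<Sum>j<n. q i j * max (v j - v i) 0) \<le> (M + 2 * vC) * (\<bar>q i i\<bar> + 1)"
      using vC0 by (simp add: algebra_simps)
  qed
  have \<mu>U: "summable (\<lambda>i. \<mu> i * U i)"
  proof (rule summable_comparison_test_ev)
    obtain B where B: "\<And>i. i \<in> C \<Longrightarrow> i < B"
      using C by (auto simp: finite_nat_set_iff_bounded)
    show "\<forall>\<^sub>F i in sequentially. norm (\<mu> i * U i) \<le> (M + 2 * vC) * (\<mu> i * (\<bar>q i i\<bar> + 1))"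
      using eventually_ge_at_top[of B]
    proof eventually_elim
      case (elim i)
      then have "i \<notin> C" using B by force
      have "\<mu> i * U i \<le> \<mu> i * ((M + 2 * vC) * (\<bar>q i i\<bar> + 1))"
        by (rule mult_left_mono[OF U_le[OF \<open>i \<notin> C\<close>] \<mu>(1)])
      moreover have "0 \<le> \<mu> i * U i" using \<mu>(1) U0 by simp
      ultimately show ?case by (simp add: mult_ac)
    qed
    show "summable (\<lambda>i. (M + 2 * vC) * (\<mu> i * (\<bar>q i i\<bar> + 1)))"
      by (rule summable_mult[OF \<mu>(2)])
  qed
  have \<mu>G: "summable (\<lambda>i. \<mu> i * (U i + D i))"
  proof -
    have "summable (\<lambda>i. 2 * (\<mu> i * U i) - \<mu> i * z i)"
      using zs by (intro summable_diff summable_mult \<mu>U) (simp add: z_def)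
    moreover have "2 * (\<mu> i * U i) - \<mu> i * z i = \<mu> i * (U i + D i)" for i
      unfolding UD[symmetric] by (simp add: algebra_simps)
    ultimately show ?thesis by simp
  qed
  define Z where "Z n i = (\<Sum>j. q i j * min (v j) (real n))" for n i
  have min_bound: "\<bar>min (v j) (real n)\<bar> \<le> real n" for j n using v[of j] by simp
  have Z_lim: "(\<lambda>n. Z n i) \<longlonglongrightarrow> z i" for i
    unfolding Z_def z_def
  proof (rule suminf_dominated_limit[OF _ _ qv_abs])
    fix j
    have "\<forall>\<^sub>F n in sequentially. q i j * v j = q i j * min (v j) (real n)"
      using eventually_ge_at_top[of "nat \<lceil>v j\<rceil>"] by eventually_elim (simp add: min_def)
    then show "(\<lambda>n. q i j * min (v j) (real n)) \<longlonglongrightarrow> q i j * v j"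
      using tendsto_const by (rule Lim_transform_eventually[rotated])
    show "\<bar>q i j * min (v j) (real n)\<bar> \<le> \<bar>q i j * v j\<bar>" for n
      using v[of j] by (simp add: abs_mult mult_left_mono)
  qed
  \<comment> \<open>Truncation at \<open>n\<close> does not enlarge increments, so the bound is
    uniform in \<open>n\<close>.\<close>
  have Z_bound: "\<bar>Z n i\<bar> \<le> U i + D i" for n i
  proof -
    have s: "summable (\<lambda>j. q i j * min (v j) (real n))"
      by (rule summable_rabs_cancel[OF Q_bounded_mult(1)[OF cons min_bound]])
    have *: "(\<lambda>j. q i j * (min (v j) (real n) - min (v i) (real n))) sums Z n i"
    proof -
      have "(\<lambda>j. q i j * min (v j) (real n) - q i j * min (v i) (real n)) sums (Z n i - 0 * min (v i) (real n))"
        unfolding Z_def by (intro sums_diff summable_sums s sums_mult2 Q_row[OF cons])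
      then show ?thesis by (simp add: right_diff_distrib)
    qed
    have GS: "(\<lambda>j. q i j * max (v j - v i) 0 + q i j * max (v i - v j) 0) sums (U i + D i)"
      unfolding U_def D_def by (intro sums_add summable_sums U_summable D_summable)
    have le: "\<bar>q i j * (min (v j) (real n) - min (v i) (real n))\<bar> \<le>
       q i j * max (v j - v i) 0 + q i j * max (v i - v j) 0" for j
    proof (cases "i = j")
      case False
      have "\<bar>min (v j) (real n) - min (v i) (real n)\<bar> \<le> max (v j - v i) 0 + max (v i - v j) 0"
        by auto
      from mult_left_mono[OF this nonneg[OF False]] show ?thesis
        using nonneg[OF False] by (simp add: abs_mult distrib_left)
    qed simp
    have "summable (\<lambda>j. \<bar>q i j * (min (v j) (real n) - min (v i) (real n))\<bar>)"
      by (rule summable_comparison_test'[OF sums_summable[OF GS]]) (use le in auto)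
    from summable_rabs[OF this] suminf_le[OF le this sums_summable[OF GS]]
    show ?thesis using sums_unique[OF *] sums_unique[OF GS] by simp
  qed
  have "(\<lambda>n. \<Sum>i. \<mu> i * Z n i) \<longlonglongrightarrow> (\<Sum>i. \<mu> i * z i)"
  proof (rule suminf_dominated_limit[OF _ _ \<mu>G])
    show "(\<lambda>n. \<mu> i * Z n i) \<longlonglongrightarrow> \<mu> i * z i" for i
      by (intro tendsto_intros Z_lim)
    show "\<bar>\<mu> i * Z n i\<bar> \<le> \<mu> i * (U i + D i)" for n i
      using \<mu>(1)[of i] Z_bound[of n i] by (simp add: abs_mult mult_left_mono)
  qed
  moreover have "(\<Sum>i. \<mu> i * Z n i) = 0" for n
  proof -
    have "summable (\<lambda>i. \<mu> i * \<bar>q i i\<bar>)"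
      by (rule summable_comparison_test'[OF \<mu>(2)]) (use \<mu>(1) in \<open>simp add: abs_mult mult_left_mono\<close>)
    from invariant_test_function[OF cons \<mu>(1) this min_bound \<mu>(3)]
    show ?thesis unfolding Z_def by (rule sums_unique[symmetric])
  qed
  ultimately have "(\<Sum>i. \<mu> i * z i) = 0" by (simp add: LIMSEQ_const_iff)
  then show ?thesis by (simp add: z_def)
qed

text \<open>The positive part of \<open>\<pi> - p s\<close> is dominated by \<open>\<pi>\<close>, so
  its sum tends to zero; as both vectors have mass one, the distance is twice that sum.\<close>

lemma prob_vectors_l1_limit:
  fixes p :: "nat \<Rightarrow> nat \<Rightarrow> real"
  assumes p: "\<And>s i. 0 \<le> p s i" "\<And>s. p s sums 1" and \<pi>: "\<And>i. 0 \<le> \<pi> i" "\<pi> sums 1"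
    and lim: "\<And>i. (\<lambda>s. p s i) \<longlonglongrightarrow> \<pi> i"
  shows "(\<lambda>s. \<Sum>i. \<bar>p s i - \<pi> i\<bar>) \<longlonglongrightarrow> 0"
proof -
  have dom: "\<bar>max (\<pi> i - p s i) 0\<bar> \<le> \<pi> i" for s i using p(1)[of s i] \<pi>(1)[of i] by auto
  have "(\<lambda>s. max (\<pi> i - p s i) 0) \<longlonglongrightarrow> max (\<pi> i - \<pi> i) 0" for i
    by (intro tendsto_intros lim)
  from suminf_dominated_limit[OF this dom sums_summable[OF \<pi>(2)]]
  have *: "(\<lambda>s. \<Sum>i. max (\<pi> i - p s i) 0) \<longlonglongrightarrow> 0" by simp
  have "(\<Sum>i. \<bar>p s i - \<pi> i\<bar>) = 2 * (\<Sum>i. max (\<pi> i - p s i) 0)" for s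
  proof -
    have "summable (\<lambda>i. max (\<pi> i - p s i) 0)"
      by (rule summable_comparison_test'[OF sums_summable[OF \<pi>(2)]]) (use dom in simp)
    then have "(\<lambda>i. 2 * max (\<pi> i - p s i) 0 + (p s i - \<pi> i)) sums
       (2 * (\<Sum>i. max (\<pi> i - p s i) 0) + (1 - 1))"
      by (intro sums_add sums_mult sums_diff p \<pi> summable_sums)
    moreover have "(\<lambda>i. 2 * max (\<pi> i - p s i) 0 + (p s i - \<pi> i)) = (\<lambda>i. \<bar>p s i - \<pi> i\<bar>)"
      by (auto simp: max_def)
    ultimately have "(\<lambda>i. \<bar>p s i - \<pi> i\<bar>) sums (2 * (\<Sum>i. max (\<pi> i - p s i) 0))" by simp
    then show ?thesis by (rule sums_unique[symmetric])
  qed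
  then show ?thesis using tendsto_mult[OF tendsto_const[of 2] *] by simp
qed

text \<open>Tychonoff's theorem for the cube replaces a diagonal argument; a countable product of
  real lines is first countable, so compactness yields convergent subsequences.\<close>

lemma pointwise_bounded_subsequence:
  fixes p :: "nat \<Rightarrow> nat \<Rightarrow> real"
  assumes "\<And>s i. p s i \<in> {0..1}"
  obtains r \<mu> where "strict_mono r" "\<And>i. (\<lambda>s. p (r s) i) \<longlonglongrightarrow> \<mu> i"
proof -
  have "compactin (product_topology (\<lambda>_::nat. euclidean) UNIV) (Pi\<^sub>E UNIV (\<lambda>_. {0..1::real}))"
    by (subst compactin_PiE) auto
  then have "compact (Pi\<^sub>E UNIV (\<lambda>_::nat. {0..1::real}))"
    by (simp add: euclidean_product_topology)
  then have "seq_compact (Pi\<^sub>E UNIV (\<lambda>_::nat. {0..1::real}))"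
    by (rule compact_imp_seq_compact)
  moreover have "\<forall>s. p s \<in> Pi\<^sub>E UNIV (\<lambda>_. {0..1})" using assms by auto
  ultimately obtain \<mu> r where r: "strict_mono r" "(p \<circ> r) \<longlonglongrightarrow> \<mu>"
    by (rule seq_compactE)
  have "(\<lambda>s. p (r s) i) \<longlonglongrightarrow> \<mu> i" for i
    using continuous_on_tendsto_compose[OF continuous_on_product_coordinates[of i] r(2)] by simp
  with r(1) that show thesis by blast
qed

text \<open>The nonnegative functions \<open>b' 1\<^sub>C - w s\<close> dominate \<open>1\<close> and have mean \<open>b' p s (C)\<close> under \<open>p s\<close>. Since
  \<open>\<mu> Q v = 0\<close>, their limit has mean \<open>b' \<mu> (C)\<close> under \<open>\<mu>\<close>, so none of these means escapes to infinity;
  hence neither does any mass of \<open>p s\<close>.\<close>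

lemma drift_bounded_limit:
  fixes q :: "nat \<Rightarrow> nat \<Rightarrow> real" and p w :: "nat \<Rightarrow> nat \<Rightarrow> real" and v \<mu> \<pi> :: "nat \<Rightarrow> real"
  assumes cons: "conservative_Q_matrix q" and irr: "Q_irreducible q"
    and stat: "stationary_distribution q \<pi>"
    and col: "\<And>j. finite {i. q i j \<noteq> 0}"
    and v: "\<And>i. 0 \<le> v i" and qv: "\<And>i. summable (\<lambda>j. q i j * v j)"
    and C: "finite C"
    and up: "\<And>i F. i \<notin> C \<Longrightarrow> finite F \<Longrightarrow> F \<subseteq> - C \<Longrightarrow>
       (\<Sum>j\<in>F. q i j * max (v j - v i) 0) \<le> M * (\<bar>q i i\<bar> + 1)"
    and p: "\<And>s i. 0 \<le> p s i" "\<And>s. p s sums 1"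
    and pw: "\<And>s. (\<lambda>i. p s i * w s i) sums 0"
    and drift: "\<And>s i. p s i * w s i \<le> p s i * (- \<bar>q i i\<bar> - 1 + b' * indicator C i)"
    and inv: "\<And>j. \<forall>\<^sub>F s in sequentially. (\<Sum>i | q i j \<noteq> 0. p s i * q i j) = 0"
    and wlim: "\<And>i. (\<lambda>s. w s i) \<longlonglongrightarrow> (\<Sum>j. q i j * v j)"
    and lim: "\<And>i. (\<lambda>s. p s i) \<longlonglongrightarrow> \<mu> i"
  shows "\<mu> i = \<pi> i"
proof -
  define A where "A i = \<bar>q i i\<bar> + 1" for i
  define z where "z i = (\<Sum>j. q i j * v j)" for i
  define h where "h s i = p s i * (b' * indicator C i - w s i)" for s i
  define g where "g i = \<mu> i * (b' * indicator C i - z i)" for i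
  define pC where "pC s = (\<Sum>i\<in>C. p s i)" for s
  define \<mu>C where "\<mu>C = (\<Sum>i\<in>C. \<mu> i)"
  have A: "1 \<le> A i" for i by (simp add: A_def)
  have ind_sums: "(\<lambda>i. x i * (b' * indicator C i)) sums (b' * (\<Sum>i\<in>C. x i))" for x :: "nat \<Rightarrow> real"
    using sums_finite[OF C, of "\<lambda>i. x i * (b' * indicator C i)"]
    by (simp add: sum_distrib_left mult_ac)
  have h_sums: "h s sums (b' * pC s)" for s
    using sums_diff[OF ind_sums pw, of "p s" s] by (simp add: h_def[abs_def] pC_def right_diff_distrib)
  have h_ge: "p s i * A i \<le> h s i" for s i
    using drift[of s i] by (simp add: h_def A_def algebra_simps)
  have p_le: "p s i \<le> p s i * A i" for s i
    using mult_left_mono[OF A[of i] p(1)[of s i]] by simp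
  have h0: "0 \<le> h s i" for s i using p(1)[of s i] p_le[of s i] h_ge[of s i] by linarith
  have h_lim: "(\<lambda>s. h s i) \<longlonglongrightarrow> g i" for i
    unfolding h_def g_def z_def by (intro tendsto_intros lim wlim)
  have pC_lim: "(\<lambda>s. b' * pC s) \<longlonglongrightarrow> b' * \<mu>C"
    unfolding pC_def \<mu>C_def by (intro tendsto_intros lim)
  have \<mu>0: "0 \<le> \<mu> i" for i
    using LIMSEQ_le_const[OF lim] p(1) by blast
  have g_ge: "\<mu> i * A i \<le> g i" for i
    using LIMSEQ_le[OF tendsto_mult[OF lim tendsto_const] h_lim] h_ge by blast
  have g0: "0 \<le> g i" for i using g_ge[of i] \<mu>0[of i] A[of i] by (smt (verit) mult_nonneg_nonneg)
  \<comment> \<open>The Fatou half of the limit: partial sums give an upper bound, enough for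
    summability. Equality has to wait for \<mu> Q v = 0.\<close>
  have g_part: "(\<Sum>i<n. g i) \<le> b' * \<mu>C" for n
  proof (rule LIMSEQ_le[OF _ pC_lim])
    show "(\<lambda>s. \<Sum>i<n. h s i) \<longlonglongrightarrow> (\<Sum>i<n. g i)" by (intro tendsto_sum h_lim)
    have "(\<Sum>i<n. h s i) \<le> b' * pC s" for s
      using sum_le_suminf[OF sums_summable[OF h_sums], of "{..<n}" s] h0 sums_unique[OF h_sums, of s] by simp
    then show "\<exists>N. \<forall>s\<ge>N. (\<Sum>i<n. h s i) \<le> b' * pC s" by blast
  qed
  have g_summable: "summable g" by (rule summableI_nonneg_bounded[OF g0 g_part])
  have \<mu>A: "summable (\<lambda>i. \<mu> i * A i)"
    by (rule summable_comparison_test'[OF g_summable])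
      (use g_ge \<mu>0 A in \<open>simp add: A_def abs_mult\<close>)
  have \<mu>q: "summable (\<lambda>i. \<mu> i * \<bar>q i i\<bar>)"
    by (rule summable_comparison_test'[OF \<mu>A])
      (use \<mu>0 in \<open>simp add: A_def abs_mult distrib_left\<close>)
  have \<mu>_inv: "(\<lambda>i. \<mu> i * q i j) sums 0" for j
  proof -
    have "(\<lambda>s. \<Sum>i | q i j \<noteq> 0. p s i * q i j) \<longlonglongrightarrow> (\<Sum>i | q i j \<noteq> 0. \<mu> i * q i j)"
      by (intro tendsto_intros lim)
    moreover have "(\<lambda>s. \<Sum>i | q i j \<noteq> 0. p s i * q i j) \<longlonglongrightarrow> 0"
      by (rule tendsto_eventually[OF inv])
    ultimately have "(\<Sum>i | q i j \<noteq> 0. \<mu> i * q i j) = 0"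
      by (rule LIMSEQ_unique)
    then show ?thesis using sums_finite[OF col, of j "\<lambda>i. \<mu> i * q i j"] by simp
  qed
  \<comment> \<open>Since \<open>p s\<close> has mass one and lies below \<open>h s\<close>, the set
    \<open>C\<close> keeps mass at least \<open>1 / b'\<close>; it is finite, so the limit inherits
    the bound and is not zero.\<close>
  have "1 \<le> b' * \<mu>C"
  proof (rule LIMSEQ_le_const[OF pC_lim])
    have "p s i \<le> h s i" for s i using p_le[of s i] h_ge[of s i] by linarith
    then have "1 \<le> b' * pC s" for s
      using sums_le[OF _ p(2) h_sums] by blast
    then show "\<exists>N. \<forall>s\<ge>N. 1 \<le> b' * pC s" by blast
  qed
  then have "\<mu>C \<noteq> 0" by auto
  have \<mu>_pos: "0 < \<mu> i" for i
  proof (rule ccontr)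
    assume "\<not> 0 < \<mu> i"
    then have "\<mu> i = 0" using \<mu>0[of i] by simp
    then have "\<mu> k = 0" for k
      using invariant_zero[OF cons irr \<mu>0 \<mu>_inv] by blast
    then show False using \<open>\<mu>C \<noteq> 0\<close> by (simp add: \<mu>C_def)
  qed
  have \<mu>z: "summable (\<lambda>i. \<mu> i * z i)"
  proof -
    have "summable (\<lambda>i. \<mu> i * (b' * indicator C i) - g i)"
      by (intro summable_diff sums_summable[OF ind_sums] g_summable)
    then show ?thesis by (simp add: g_def right_diff_distrib)
  qed
  have "(\<Sum>i. \<mu> i * z i) = 0"
    unfolding z_def
    by (rule truncated_drift_limit[OF cons \<mu>0 _ \<mu>_inv v qv _ C up])
      (use \<mu>A \<mu>z in \<open>simp_all add: A_def z_def\<close>)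
  then have g_sums: "g sums (b' * \<mu>C)"
    using sums_diff[OF ind_sums summable_sums[OF \<mu>z], of \<mu>]
    by (simp add: g_def[abs_def] \<mu>C_def right_diff_distrib)
  have \<mu>_summable: "summable \<mu>"
    by (rule summable_comparison_test'[OF \<mu>A])
      (use \<mu>0 in \<open>simp add: A_def abs_mult distrib_left\<close>)
  \<comment> \<open>Beyond \<open>n\<close>, \<open>p s\<close> has no more mass than
    \<open>h s\<close>. Written with totals minus finite sums, the comparison survives the limit in
    \<open>s\<close>.\<close>
  have tail: "1 - (\<Sum>i<n. \<mu> i) \<le> b' * \<mu>C - (\<Sum>i<n. g i)" for n
  proof (rule LIMSEQ_le)
    show "(\<lambda>s. 1 - (\<Sum>i<n. p s i)) \<longlonglongrightarrow> 1 - (\<Sum>i<n. \<mu> i)" by (intro tendsto_intros lim)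
    show "(\<lambda>s. b' * pC s - (\<Sum>i<n. h s i)) \<longlonglongrightarrow> b' * \<mu>C - (\<Sum>i<n. g i)"
      by (intro tendsto_intros pC_lim h_lim)
    have "1 - (\<Sum>i<n. p s i) \<le> b' * pC s - (\<Sum>i<n. h s i)" for s
    proof -
      have d: "(\<lambda>i. h s i - p s i) sums (b' * pC s - 1)" by (intro sums_diff h_sums p)
      have "0 \<le> h s i - p s i" for i using p_le[of s i] h_ge[of s i] by linarith
      then have "(\<Sum>i<n. h s i - p s i) \<le> b' * pC s - 1"
        using sum_le_suminf[OF sums_summable[OF d], of "{..<n}"] sums_unique[OF d] by simp
      then show ?thesis by (simp add: sum_subtractf)
    qed
    then show "\<exists>N. \<forall>s\<ge>N. 1 - (\<Sum>i<n. p s i) \<le> b' * pC s - (\<Sum>i<n. h s i)" by blast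
  qed
  have "1 - (\<Sum>i. \<mu> i) \<le> b' * \<mu>C - b' * \<mu>C"
  proof (rule LIMSEQ_le)
    show "(\<lambda>n. 1 - (\<Sum>i<n. \<mu> i)) \<longlonglongrightarrow> 1 - (\<Sum>i. \<mu> i)"
      by (intro tendsto_intros summable_LIMSEQ \<mu>_summable)
    show "(\<lambda>n. b' * \<mu>C - (\<Sum>i<n. g i)) \<longlonglongrightarrow> b' * \<mu>C - b' * \<mu>C"
      using g_sums by (intro tendsto_intros) (simp add: sums_def)
  qed (use tail in blast)
  moreover have "(\<Sum>i. \<mu> i) \<le> 1"
  proof (rule suminf_le_const[OF \<mu>_summable])
    fix n
    have "(\<Sum>i<n. p s i) \<le> 1" for s
      using sum_le_suminf[OF sums_summable[OF p(2)], of "{..<n}" s] p(1) sums_unique[OF p(2)] by simp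
    then show "(\<Sum>i<n. \<mu> i) \<le> 1"
      by (intro LIMSEQ_le_const2[OF tendsto_sum[OF lim]]) auto
  qed
  ultimately have \<mu>1: "\<mu> sums 1"
    using summable_sums[OF \<mu>_summable] by (simp add: order_antisym)
  have \<pi>: "\<And>i. 0 \<le> \<pi> i" "\<And>j. (\<lambda>i. \<pi> i * q i j) sums 0" "\<pi> sums 1"
    using stat less_imp_le unfolding stationary_distribution_def by blast+
  \<comment> \<open>Proportionality; summing over \<open>k\<close> fixes the factor, as both vectors
    have mass one.\<close>
  have "\<pi> i * \<mu> k = \<pi> k * \<mu> i" for k
    by (rule invariant_measure_unique[OF cons irr \<mu>_pos \<mu>q \<mu>_inv \<pi>(1,2)])
  then show ?thesis
    using sums_unique2[of "\<lambda>k. \<pi> i * \<mu> k" "\<pi> i * 1" "1 * \<mu> i"] sums_mult[OF \<mu>1, of "\<pi> i"]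
      sums_mult2[OF \<pi>(3), of "\<mu> i"] by simp
qed

text \<open>A subsequence bounded away from \<open>\<pi>\<close> would have a further subsequence
  converging pointwise, necessarily to \<open>\<pi>\<close> and hence in norm. The factor
  \<open>p s i\<close> in \<open>drift\<close> restricts the inequality to states that the
  truncation contains.\<close>

lemma drift_bounded_l1_limit:
  fixes q :: "nat \<Rightarrow> nat \<Rightarrow> real" and p w :: "nat \<Rightarrow> nat \<Rightarrow> real" and v \<pi> :: "nat \<Rightarrow> real"
  assumes cons: "conservative_Q_matrix q" and irr: "Q_irreducible q"
    and stat: "stationary_distribution q \<pi>"
    and col: "\<And>j. finite {i. q i j \<noteq> 0}"
    and v: "\<And>i. 0 \<le> v i" and qv: "\<And>i. summable (\<lambda>j. q i j * v j)"
    and C: "finite C"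
    and up: "\<And>i F. i \<notin> C \<Longrightarrow> finite F \<Longrightarrow> F \<subseteq> - C \<Longrightarrow>
       (\<Sum>j\<in>F. q i j * max (v j - v i) 0) \<le> M * (\<bar>q i i\<bar> + 1)"
    and p: "\<And>s i. 0 \<le> p s i" "\<And>s. p s sums 1"
    and pw: "\<And>s. (\<lambda>i. p s i * w s i) sums 0"
    and drift: "\<And>s i. p s i * w s i \<le> p s i * (- \<bar>q i i\<bar> - 1 + b' * indicator C i)"
    and inv: "\<And>j. \<forall>\<^sub>F s in sequentially. (\<Sum>i | q i j \<noteq> 0. p s i * q i j) = 0"
    and wlim: "\<And>i. (\<lambda>s. w s i) \<longlonglongrightarrow> (\<Sum>j. q i j * v j)"
  shows "(\<lambda>s. l1_norm (\<lambda>i. p s i - \<pi> i)) \<longlonglongrightarrow> 0"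
proof (rule ccontr)
  define d where "d s = l1_norm (\<lambda>i. p s i - \<pi> i)" for s
  assume "\<not> (\<lambda>s. l1_norm (\<lambda>i. p s i - \<pi> i)) \<longlonglongrightarrow> 0"
  then obtain e where e: "0 < e" and "\<not> (\<forall>\<^sub>F s in sequentially. \<bar>d s\<bar> < e)"
    by (auto simp: tendsto_iff dist_real_def d_def)
  then have "infinite {s. e \<le> \<bar>d s\<bar>}"
    by (simp add: eventually_cofinite not_less flip: cofinite_eq_sequentially)
  then obtain r :: "nat \<Rightarrow> nat" where r: "strict_mono r" and d_ge: "\<And>s. e \<le> \<bar>d (r s)\<bar>"
    using infinite_enumerate by blast
  have "p (r s) i \<le> 1" for s i
    using sum_le_suminf[OF sums_summable[OF p(2)], of "{i}" "r s"] p(1) sums_unique[OF p(2)] by simp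
  then have "p (r s) i \<in> {0..1}" for s i using p(1) by simp
  then obtain r' \<mu> where r': "strict_mono r'" and \<mu>: "\<And>i. (\<lambda>s. p (r (r' s)) i) \<longlonglongrightarrow> \<mu> i"
    using pointwise_bounded_subsequence[of "\<lambda>s. p (r s)"] by blast
  have rr: "filterlim (\<lambda>s. r (r' s)) sequentially sequentially"
    using filterlim_subseq[OF strict_mono_o[OF r r']] by (simp add: o_def)
  have "\<mu> i = \<pi> i" for i
    by (rule drift_bounded_limit[OF cons irr stat col v qv C up,
          where p = "\<lambda>s. p (r (r' s))" and w = "\<lambda>s. w (r (r' s))" and b' = b'])
      (assumption | rule p pw drift \<mu> eventually_compose_filterlim[OF inv rr] filterlim_compose[OF wlim rr])+
  then have "(\<lambda>s. p (r (r' s)) i) \<longlonglongrightarrow> \<pi> i" for i using \<mu>[of i] by simp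
  then have "(\<lambda>s. d (r (r' s))) \<longlonglongrightarrow> 0"
    unfolding d_def l1_norm_def
    by (intro prob_vectors_l1_limit p)
      (use stat in \<open>auto simp: stationary_distribution_def intro: less_imp_le\<close>)
  then have "\<forall>\<^sub>F s in sequentially. \<bar>d (r (r' s))\<bar> < e"
    using e by (simp add: tendsto_iff dist_real_def)
  then show False using d_ge eventually_happens' by (fastforce simp: not_less[symmetric])
qed

section \<open>Truncations and block elimination\<close>

text \<open>The states where \<open>x\<close> is negative form a finite closed set, which irreducibility forces to be empty.\<close>

lemma truncated_row_nonneg:
  fixes q :: "nat \<Rightarrow> nat \<Rightarrow> real" and x :: "nat \<Rightarrow> real"
  assumes cons: "conservative_Q_matrix q" and irr: "Q_irreducible q"
    and x: "\<And>j. j < N \<Longrightarrow> (\<Sum>i<N. x i * q i j) \<le> 0" and i: "i < N"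
  shows "0 \<le> x i"
proof -
  define F where "F = {i. i < N \<and> x i < 0}"
  have F: "finite F" by (simp add: F_def)
  have row_le: "(\<Sum>j\<in>G. q k j) \<le> 0" if "finite G" "k \<in> G" for G k
    using sum_le_suminf[OF sums_summable[OF Q_row[OF cons]], of G k] that Q_nonneg[OF cons, of k]
      sums_unique[OF Q_row[OF cons, of k]] by fastforce
  \<comment> \<open>For \<open>k < N\<close> the factors of \<open>c k\<close> have equal sign: both
    are nonpositive on \<open>F\<close> and nonnegative off \<open>F\<close>. The columns in
    \<open>F\<close> bound the total by zero, so every \<open>c k\<close> vanishes and the rates
    within \<open>F\<close> already exhaust its rows.\<close>
  define c where "c k = x k * (\<Sum>j\<in>F. q k j)" for k
  have c0: "0 \<le> c k" if "k < N" for k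
  proof (cases "k \<in> F")
    case True
    then show ?thesis using row_le[OF F True] by (auto simp: c_def F_def intro: mult_nonpos_nonpos)
  next
    case False
    then have "0 \<le> q k j" if "j \<in> F" for j using Q_nonneg[OF cons] that by metis
    then show ?thesis using False \<open>k < N\<close> by (auto simp: c_def F_def intro!: mult_nonneg_nonneg sum_nonneg)
  qed
  have "(\<Sum>k<N. c k) = (\<Sum>j\<in>F. \<Sum>k<N. x k * q k j)"
    unfolding c_def sum_distrib_left by (rule sum.swap)
  also have "\<dots> \<le> 0"
    by (intro sum_nonpos x) (auto simp: F_def)
  finally have "(\<Sum>k<N. c k) = 0" using c0 by (intro antisym sum_nonneg) auto
  then have c: "c k = 0" if "k < N" for k
    using c0 that sum_nonneg_eq_0_iff[of "{..<N}" c] by auto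
  have "closed_states q F"
    unfolding closed_states_def
  proof (intro ballI allI impI)
    fix k l assume kl: "k \<in> F" "l \<notin> F"
    then have "(\<Sum>j\<in>F. q k j) = 0" using c[of k] by (auto simp: c_def F_def)
    then have "q k l \<le> 0" using row_le[of "insert l F" k] kl F by simp
    moreover have "0 \<le> q k l" using Q_nonneg[OF cons, of k l] kl by metis
    ultimately show "q k l = 0" by simp
  qed
  then have "F = {} \<or> F = UNIV" using irr unfolding Q_irreducible_def by blast
  then have "F = {}" using F infinite_UNIV_nat by auto
  then have "i \<notin> F" by simp
  then show ?thesis using i by (simp add: F_def)
qed

text \<open>The sign comparison applied to both differences. This is the nonsingularity of the
  truncation, in the row form used below.\<close>

lemma truncated_row_unique:
  fixes q :: "nat \<Rightarrow> nat \<Rightarrow> real" and x y :: "nat \<Rightarrow> real"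
  assumes cons: "conservative_Q_matrix q" and irr: "Q_irreducible q"
    and xy: "\<And>j. j < N \<Longrightarrow> (\<Sum>i<N. x i * q i j) = (\<Sum>i<N. y i * q i j)" and i: "i < N"
  shows "x i = y i"
proof -
  have "0 \<le> x i - y i" "0 \<le> y i - x i"
    by (rule truncated_row_nonneg[OF cons irr _ i], simp add: left_diff_distrib sum_subtractf xy)+
  then show ?thesis by simp
qed

text \<open>A zero determinant would give a kernel vector of the transpose. The criterion is put in
  terms of row vectors to match the comparison argument, and it makes \<open>mat_inv\<close> a
  genuine inverse.\<close>

lemma mat_inv_left_kernel:
  fixes A :: "real mat"
  assumes A: "A \<in> carrier_mat n n"
    and ker: "\<And>x. \<forall>j<n. (\<Sum>i<n. x i * A $$ (i, j)) = 0 \<Longrightarrow> \<forall>i<n. x i = 0"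
  shows "mat_inv A \<in> carrier_mat n n" "A * mat_inv A = 1\<^sub>m n" "mat_inv A * A = 1\<^sub>m n"
proof -
  have "Determinant.det A \<noteq> 0"
  proof
    assume "Determinant.det A = 0"
    then have "Determinant.det (transpose_mat A) = 0" using det_transpose[OF A] by simp
    then obtain v where v: "v \<in> carrier_vec n" "v \<noteq> 0\<^sub>v n" "transpose_mat A *\<^sub>v v = 0\<^sub>v n"
      using det_0_iff_vec_prod_zero_field[of "transpose_mat A" n] A by auto
    have "(\<Sum>i<n. vec_index v i * A $$ (i, j)) = 0" if "j < n" for j
    proof -
      have "vec_index (transpose_mat A *\<^sub>v v) j = (\<Sum>i<n. vec_index v i * A $$ (i, j))"
        using A v(1) that by (simp add: scalar_prod_def lessThan_atLeast0 mult.commute)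
      then show ?thesis using v(3) that by simp
    qed
    then have "vec_index v i = 0" if "i < n" for i using ker[of "vec_index v"] that by blast
    then have "v = 0\<^sub>v n" using v by (intro eq_vecI) auto
    then show False using v by simp
  qed
  then have "A \<in> Units (ring_mat TYPE(real) n n)" by (rule det_non_zero_imp_unit[OF A])
  then have "mat_inverse A \<noteq> None" using mat_inverse(1)[OF A, where b = n] by blast
  then have "mat_inverse A = Some (mat_inv A)" by simp
  from mat_inverse(2)[OF A this]
  show "mat_inv A \<in> carrier_mat n n" "A * mat_inv A = 1\<^sub>m n" "mat_inv A * A = 1\<^sub>m n" by auto
qed

lemma mat_mult_entry:
  assumes "A \<in> carrier_mat nr n" "B \<in> carrier_mat n nc" "i < nr" "j < nc"
  shows "(A * B) $$ (i, j) = (\<Sum>k<n. A $$ (i, k) * B $$ (k, j))"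
  using assms by (auto simp: scalar_prod_def lessThan_atLeast0)

lemma mat_sum_carrier [simp]: "mat_sum nr nc F n \<in> carrier_mat nr nc"
  by (simp add: mat_sum_def)

lemma mat_sum_entry:
  "i < nr \<Longrightarrow> j < nc \<Longrightarrow> mat_sum nr nc F n $$ (i, j) = (\<Sum>l<n. F l $$ (i, j))"
  by (simp add: mat_sum_def)

lemma mult_mat_sum:
  assumes A: "A \<in> carrier_mat nr k" and F: "\<And>l. l < n \<Longrightarrow> F l \<in> carrier_mat k nc"
  shows "A * mat_sum k nc F n = mat_sum nr nc (\<lambda>l. A * F l) n"
proof (rule eq_matI)
  fix i j assume "i < dim_row (mat_sum nr nc (\<lambda>l. A * F l) n)" "j < dim_col (mat_sum nr nc (\<lambda>l. A * F l) n)"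
  then have ij: "i < nr" "j < nc" by (auto simp: mat_sum_def)
  have "(A * mat_sum k nc F n) $$ (i, j) = (\<Sum>t<k. \<Sum>l<n. A $$ (i, t) * F l $$ (t, j))"
    using mat_mult_entry[OF A mat_sum_carrier ij] ij by (simp add: mat_sum_entry sum_distrib_left)
  also have "\<dots> = (\<Sum>l<n. (A * F l) $$ (i, j))"
    by (subst sum.swap) (intro sum.cong refl, use mat_mult_entry[OF A F ij] in simp)
  finally show "(A * mat_sum k nc F n) $$ (i, j) = mat_sum nr nc (\<lambda>l. A * F l) n $$ (i, j)"
    using ij by (simp add: mat_sum_entry)
qed (use A in \<open>auto simp: mat_sum_def\<close>)

section \<open>Indexing of states by level and offset\<close>

lemma level_start_Suc: "level_start m (Suc s) = level_start m s + m s"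
  by (simp add: level_start_def)

lemma level_start_mono: "k \<le> l \<Longrightarrow> level_start m k \<le> level_start m l"
  unfolding level_start_def by (rule sum_mono2) auto

lemma level_offset_less:
  assumes "j < m k" "k < n"
  shows "level_start m k + j < level_start m n"
  using level_start_mono[of "Suc k" n m] assms by (simp add: level_start_Suc)

lemma sum_levels:
  fixes f :: "nat \<Rightarrow> real"
  shows "(\<Sum>t<level_start m n. f t) = (\<Sum>l<n. \<Sum>j<m l. f (level_start m l + j))"
proof (induction n)
  case (Suc n)
  have "{..<level_start m n + m n} = {..<level_start m n} \<union> {level_start m n..<level_start m n + m n}"
    by auto
  then have "(\<Sum>t<level_start m n + m n. f t) =
     (\<Sum>t<level_start m n. f t) + (\<Sum>t\<in>{level_start m n..<level_start m n + m n}. f t)"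
    by (simp add: sum.union_disjoint ivl_disj_int)
  also have "(\<Sum>t\<in>{level_start m n..<level_start m n + m n}. f t) = (\<Sum>j<m n. f (level_start m n + j))"
    using sum.shift_bounds_nat_ivl[of f 0 "level_start m n" "m n"]
    by (simp add: add.commute lessThan_atLeast0)
  finally show ?case using Suc by (simp add: level_start_Suc)
qed (simp add: level_start_def)

lemma level_offset_unique:
  assumes "i < m k" "j < m l" "level_start m k + i = level_start m l + j"
  shows "k = l \<and> i = j"
proof -
  have "\<not> k < l" using level_start_mono[of "Suc k" l m] assms by (auto simp: level_start_Suc)
  moreover have "\<not> l < k" using level_start_mono[of "Suc l" k m] assms by (auto simp: level_start_Suc)
  ultimately show ?thesis using assms by auto
qed

lemma level_offset_below:
  assumes "t < level_start m n"
  obtains l j where "l < n" "j < m l" "t = level_start m l + j"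
proof -
  have "\<exists>l<n. \<exists>j<m l. t = level_start m l + j"
    using assms
  proof (induction n)
    case (Suc n)
    show ?case
    proof (cases "t < level_start m n")
      case True
      then show ?thesis using Suc.IH less_SucI by blast
    next
      case False
      then have "t - level_start m n < m n" "t = level_start m n + (t - level_start m n)"
        using Suc.prems by (auto simp: level_start_Suc)
      then show ?thesis by blast
    qed
  qed (simp add: level_start_def)
  then show thesis using that by blast
qed

lemma level_start_ge: "(\<And>k. 0 < m k) \<Longrightarrow> n \<le> level_start m n"
proof (induction n)
  case (Suc n)
  have "n \<le> level_start m n" using Suc by blast
  moreover have "0 < m n" by (rule Suc.prems)
  ultimately show ?case by (simp add: level_start_Suc)
qed simp

text \<open>Glues rows given level by level into one function of the state; this is consistent
  because a state determines its level and offset.\<close>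

lemma level_function_exists:
  fixes y :: "nat \<Rightarrow> nat \<Rightarrow> real"
  shows "\<exists>f. \<forall>l. \<forall>j<m l. f (level_start m l + j) = y l j"
proof -
  define P where "P t z \<longleftrightarrow> (\<exists>l j. j < m l \<and> t = level_start m l + j \<and> z = y l j)" for t z
  have "(SOME z. P (level_start m l + j) z) = y l j" if "j < m l" for l j
  proof (rule some_equality)
    show "P (level_start m l + j) (y l j)" unfolding P_def using that by blast
  next
    fix z assume "P (level_start m l + j) z"
    then obtain l' j' where "j' < m l'" "level_start m l + j = level_start m l' + j'" "z = y l' j'"
      unfolding P_def by blast
    then show "z = y l j" using level_offset_unique[of j m l j' l'] that by simp
  qed
  then show ?thesis by (intro exI[of _ "\<lambda>t. SOME z. P t z"]) blast
qed

section \<open>Block elimination for Hessenberg truncations\<close>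

lemma block_carrier [simp]: "block m q k l \<in> carrier_mat (m k) (m l)"
  by (simp add: block_def)

lemma block_entry:
  "i < m k \<Longrightarrow> j < m l \<Longrightarrow> block m q k l $$ (i, j) = q (level_start m k + i) (level_start m l + j)"
  by (simp add: block_def)

text \<open>The pivot of block elimination at level \<open>k\<close>, a Schur complement in minus
  the truncation. The empty sum at \<open>k = 0\<close> merges the two equations for
  \<open>U_star\<close>.\<close>

definition U_pivot :: "(nat \<Rightarrow> nat) \<Rightarrow> (nat \<Rightarrow> nat \<Rightarrow> real) \<Rightarrow> nat \<Rightarrow> real mat" where
  "U_pivot m q k = - block m q k k - mat_sum (m k) (m k) (\<lambda>l. U_mat m q k l * block m q l k) k"

lemma U_pivot_carrier [simp]: "U_pivot m q k \<in> carrier_mat (m k) (m k)"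
  by (simp add: U_pivot_def minus_carrier_mat)

lemma U_star_eq: "U_star m q k = mat_inv (U_pivot m q k)"
proof (cases k)
  case 0
  have "- block m q 0 0 - mat_sum (m 0) (m 0) F 0 = - block m q 0 0" for F
    by (rule eq_matI) (auto simp: mat_sum_def block_def)
  then show ?thesis using 0 by (simp add: U_pivot_def)
qed (simp add: U_pivot_def)

lemma U_mat_refl [simp]: "U_mat m q k k = 1\<^sub>m (m k)"
  by (cases k) auto

text \<open>Records the format along with the left inverse: \<open>mat_inv\<close> has known
  dimensions only once invertibility is proved, and the product laws need them.\<close>

definition U_invertible :: "(nat \<Rightarrow> nat) \<Rightarrow> (nat \<Rightarrow> nat \<Rightarrow> real) \<Rightarrow> nat \<Rightarrow> bool" where
  "U_invertible m q k \<longleftrightarrow> U_star m q k \<in> carrier_mat (m k) (m k) \<and>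
     U_star m q k * U_pivot m q k = 1\<^sub>m (m k)"

lemma U_mat_carrier:
  "(\<And>l. l < s \<Longrightarrow> U_invertible m q l) \<Longrightarrow> l \<le> s \<Longrightarrow> U_mat m q s l \<in> carrier_mat (m s) (m l)"
proof (induction s)
  case (Suc s)
  show ?case
  proof (cases "l \<le> s")
    case True
    moreover have "U_star m q s \<in> carrier_mat (m s) (m s)"
      using Suc.prems(1)[of s] by (simp add: U_invertible_def)
    moreover have "U_mat m q s l \<in> carrier_mat (m s) (m l)" using True Suc by simp
    ultimately show ?thesis by (auto intro!: mult_carrier_mat)
  next
    case False
    then have "l = Suc s" using Suc.prems by simp
    then show ?thesis by simp
  qed
qed simp

text \<open>Splits the defining product at level \<open>k\<close>, so that the pivot of that level
  can be factored out of the terms below it.\<close>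

lemma U_mat_mult:
  "(\<And>l. l < s \<Longrightarrow> U_invertible m q l) \<Longrightarrow> l \<le> k \<Longrightarrow> k \<le> s \<Longrightarrow>
    U_mat m q s l = U_mat m q s k * U_mat m q k l"
proof (induction s)
  case (Suc s)
  show ?case
  proof (cases "k = Suc s")
    case True
    then have "U_mat m q k l \<in> carrier_mat (m k) (m l)" using Suc.prems by (intro U_mat_carrier) auto
    then show ?thesis using True by (simp add: left_mult_one_mat)
  next
    case False
    then have k: "k \<le> s" "l \<le> s" using Suc.prems by auto
    have us: "U_star m q s \<in> carrier_mat (m s) (m s)"
      using Suc.prems(1)[of s] by (simp add: U_invertible_def)
    have "U_mat m q s k \<in> carrier_mat (m s) (m k)" "U_mat m q k l \<in> carrier_mat (m k) (m l)"
      using Suc.prems k by (auto intro!: U_mat_carrier)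
    moreover have "U_mat m q s l = U_mat m q s k * U_mat m q k l" using Suc k by simp
    moreover have "block m q (Suc s) s * U_star m q s \<in> carrier_mat (m (Suc s)) (m s)"
      using us by (auto intro!: mult_carrier_mat)
    ultimately show ?thesis using k by (simp add: assoc_mult_mat)
  qed
qed simp

text \<open>For \<open>k < s\<close> the terms with \<open>l \<le> k\<close> add up to minus
  \<open>U_mat m q s k * U_pivot m q k\<close>. As \<open>U_star m q k\<close> cancels the pivot,
  this is minus \<open>U_mat m q s (Suc k) * block m q (Suc k) k\<close>, which the term
  \<open>l = Suc k\<close> compensates; Hessenberg form removes the rest.\<close>

lemma U_mat_block_sum:
  assumes hess: "upper_block_Hessenberg m q"
    and inv: "\<And>l. l < s \<Longrightarrow> U_invertible m q l"
    and k: "k \<le> s" and i: "i < m s" and j: "j < m k"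
  shows "(\<Sum>l<Suc s. (U_mat m q s l * block m q l k) $$ (i, j)) =
    (if k = s then - U_pivot m q s $$ (i, j) else 0)"
proof (cases "k = s")
  case True
  have "U_pivot m q s $$ (i, j) = - block m q s s $$ (i, j) - (\<Sum>l<s. (U_mat m q s l * block m q l s) $$ (i, j))"
    using i j True unfolding U_pivot_def
    by (subst index_minus_mat) (auto simp: mat_sum_entry mat_sum_def block_def)
  then show ?thesis using True by (simp add: left_mult_one_mat[OF block_carrier])
next
  case False
  then have ks: "k < s" using k by simp
  let ?U = "U_mat m q s" and ?B = "block m q"
  have Uc: "?U l \<in> carrier_mat (m s) (m l)" if "l \<le> s" for l using U_mat_carrier inv that by blast
  have Uk: "U_mat m q k l \<in> carrier_mat (m k) (m l)" if "l \<le> k" for l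
    using inv ks that by (intro U_mat_carrier) auto
  have us: "U_star m q k \<in> carrier_mat (m k) (m k)" "U_star m q k * U_pivot m q k = 1\<^sub>m (m k)"
    using inv[OF ks] by (auto simp: U_invertible_def)
  have BU: "?B (Suc k) k * U_star m q k \<in> carrier_mat (m (Suc k)) (m k)"
    using us by (auto intro!: mult_carrier_mat)
  have "?U k = ?U (Suc k) * U_mat m q (Suc k) k"
    using inv ks by (intro U_mat_mult) auto
  also have "U_mat m q (Suc k) k = ?B (Suc k) k * U_star m q k"
    using BU by (simp add: right_mult_one_mat)
  finally have "?U k * U_pivot m q k = ?U (Suc k) * (?B (Suc k) k * (U_star m q k * U_pivot m q k))"
    using Uc[of "Suc k"] ks us(1) BU
    by (simp add: assoc_mult_mat[OF Uc[of "Suc k"] BU U_pivot_carrier[of m q k]]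
        assoc_mult_mat[OF block_carrier[of m q "Suc k" k] us(1) U_pivot_carrier[of m q k]])
  then have e1: "?U k * U_pivot m q k = ?U (Suc k) * ?B (Suc k) k"
    by (simp add: us(2) right_mult_one_mat[OF block_carrier])
  have "?U k * U_pivot m q k =
      ?U k * - ?B k k - ?U k * mat_sum (m k) (m k) (\<lambda>l. U_mat m q k l * ?B l k) k"
    unfolding U_pivot_def using ks
    by (intro mult_minus_distrib_mat[OF Uc[of k] uminus_carrier_mat[OF block_carrier[of m q k k]]]) auto
  also have "?U k * mat_sum (m k) (m k) (\<lambda>l. U_mat m q k l * ?B l k) k =
      mat_sum (m s) (m k) (\<lambda>l. ?U k * (U_mat m q k l * ?B l k)) k"
  proof (rule mult_mat_sum[OF Uc])
    show "U_mat m q k l * ?B l k \<in> carrier_mat (m k) (m k)" if "l < k" for l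
      by (rule mult_carrier_mat[OF Uk[of l] block_carrier[of m q l k]]) (use that in simp)
  qed (use ks in simp)
  finally have e2: "?U k * U_pivot m q k =
      ?U k * - ?B k k - mat_sum (m s) (m k) (\<lambda>l. ?U k * (U_mat m q k l * ?B l k)) k" .
  have e3: "?U k * (U_mat m q k l * ?B l k) = ?U l * ?B l k" if "l < k" for l
    using ks that inv U_mat_mult[of s m q l k]
    by (simp add: assoc_mult_mat[OF Uc[of k] Uk[of l] block_carrier[of m q l k]])
  have "(?U (Suc k) * ?B (Suc k) k) $$ (i, j) =
      - (?U k * ?B k k) $$ (i, j) - (\<Sum>l<k. (?U l * ?B l k) $$ (i, j))"
  proof -
    have "(?U k * - ?B k k) $$ (i, j) = - (?U k * ?B k k) $$ (i, j)"
      using i j ks mat_mult_entry[OF Uc[of k] block_carrier[of m q k k] i j]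
        mat_mult_entry[OF Uc[of k] uminus_carrier_mat[OF block_carrier[of m q k k]] i j]
      by (simp add: sum_negf block_def)
    moreover have "mat_sum (m s) (m k) (\<lambda>l. ?U k * (U_mat m q k l * ?B l k)) k $$ (i, j) =
       (\<Sum>l<k. (?U l * ?B l k) $$ (i, j))"
      using i j by (simp add: mat_sum_entry e3)
    moreover have "(?U (Suc k) * ?B (Suc k) k) $$ (i, j) = (?U k * - ?B k k) $$ (i, j) -
       mat_sum (m s) (m k) (\<lambda>l. ?U k * (U_mat m q k l * ?B l k)) k $$ (i, j)"
      unfolding e1[symmetric] e2 using i j by (subst index_minus_mat) (auto simp: mat_sum_def)
    ultimately show ?thesis by simp
  qed
  moreover have "(\<Sum>l<Suc s. (?U l * ?B l k) $$ (i, j)) = (\<Sum>l<Suc (Suc k). (?U l * ?B l k) $$ (i, j))"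
  proof (rule sum.mono_neutral_right)
    show "\<forall>l\<in>{..<Suc s} - {..<Suc (Suc k)}. (?U l * ?B l k) $$ (i, j) = 0"
    proof
      fix l assume l: "l \<in> {..<Suc s} - {..<Suc (Suc k)}"
      then have "?B l k = 0\<^sub>m (m l) (m k)" using hess by (auto simp: upper_block_Hessenberg_def)
      then show "(?U l * ?B l k) $$ (i, j) = 0"
        using Uc[of l] l i j by (auto simp: right_mult_zero_mat)
    qed
  qed (use ks in auto)
  ultimately show ?thesis using False by simp
qed

text \<open>Elimination rows combined with weights \<open>a\<close>. It serves twice: with a kernel
  vector of the pivot, and with the row \<open>\<alpha> s * U_star m q s\<close>.\<close>

lemma U_row_solves:
  fixes y :: "nat \<Rightarrow> real"
  assumes hess: "upper_block_Hessenberg m q"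
    and inv: "\<And>l. l < s \<Longrightarrow> U_invertible m q l"
    and y: "\<And>l j. l \<le> s \<Longrightarrow> j < m l \<Longrightarrow> y (level_start m l + j) = (\<Sum>i<m s. a i * U_mat m q s l $$ (i, j))"
    and k: "k \<le> s" and j: "j < m k"
  shows "(\<Sum>t<level_start m (Suc s). y t * q t (level_start m k + j)) =
    (if k = s then - (\<Sum>i<m s. a i * U_pivot m q s $$ (i, j)) else 0)"
proof -
  have "(\<Sum>t<level_start m (Suc s). y t * q t (level_start m k + j)) =
     (\<Sum>l<Suc s. \<Sum>t<m l. (\<Sum>i<m s. a i * U_mat m q s l $$ (i, t)) * block m q l k $$ (t, j))"
    unfolding sum_levels using j by (intro sum.cong refl) (simp add: y block_entry)
  also have "\<dots> = (\<Sum>l<Suc s. \<Sum>i<m s. a i * (U_mat m q s l * block m q l k) $$ (i, j))"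
  proof (rule sum.cong[OF refl])
    fix l assume "l \<in> {..<Suc s}"
    then have "U_mat m q s l \<in> carrier_mat (m s) (m l)" using inv by (intro U_mat_carrier) auto
    then have e: "(U_mat m q s l * block m q l k) $$ (i, j) =
        (\<Sum>t<m l. U_mat m q s l $$ (i, t) * block m q l k $$ (t, j))" if "i < m s" for i
      using mat_mult_entry[OF _ block_carrier[of m q l k] that j] by blast
    have "(\<Sum>t<m l. (\<Sum>i<m s. a i * U_mat m q s l $$ (i, t)) * block m q l k $$ (t, j)) =
      (\<Sum>t<m l. \<Sum>i<m s. a i * (U_mat m q s l $$ (i, t) * block m q l k $$ (t, j)))"
      by (simp add: sum_distrib_right mult.assoc)
    also have "\<dots> = (\<Sum>i<m s. \<Sum>t<m l. a i * (U_mat m q s l $$ (i, t) * block m q l k $$ (t, j)))"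
      by (rule sum.swap)
    also have "\<dots> = (\<Sum>i<m s. a i * (U_mat m q s l * block m q l k) $$ (i, j))"
      by (intro sum.cong refl) (simp add: e flip: sum_distrib_left)
    finally show "(\<Sum>t<m l. (\<Sum>i<m s. a i * U_mat m q s l $$ (i, t)) * block m q l k $$ (t, j)) =
      (\<Sum>i<m s. a i * (U_mat m q s l * block m q l k) $$ (i, j))" .
  qed
  also have "\<dots> = (\<Sum>i<m s. \<Sum>l<Suc s. a i * (U_mat m q s l * block m q l k) $$ (i, j))"
    by (rule sum.swap)
  also have "\<dots> = (\<Sum>i<m s. a i * (if k = s then - U_pivot m q s $$ (i, j) else 0))"
    unfolding sum_distrib_left[symmetric]
    by (intro sum.cong refl, subst U_mat_block_sum[OF hess inv k _ j]) auto
  finally show ?thesis by (simp add: sum_negf)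
qed

text \<open>A left kernel vector of the pivot extends along the elimination rows to one of the
  nonsingular truncation. The last block of the extension is the vector itself, as
  \<open>U_mat m q s s\<close> is the identity.\<close>

lemma U_invertible_all:
  assumes cons: "conservative_Q_matrix q" and irr: "Q_irreducible q" and hess: "upper_block_Hessenberg m q"
  shows "U_invertible m q s"
proof (induction s rule: less_induct)
  case (less s)
  have "\<forall>i<m s. x i = 0" if x: "\<forall>j<m s. (\<Sum>i<m s. x i * U_pivot m q s $$ (i, j)) = 0" for x
  proof (intro allI impI)
    fix i assume i: "i < m s"
    obtain y where y: "\<And>l j. j < m l \<Longrightarrow> y (level_start m l + j) = (\<Sum>i<m s. x i * U_mat m q s l $$ (i, j))"
      using level_function_exists[of m "\<lambda>l j. \<Sum>i<m s. x i * U_mat m q s l $$ (i, j)"] by blast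
    have "(\<Sum>t<level_start m (Suc s). y t * q t j) = 0" if jN: "j < level_start m (Suc s)" for j
    proof -
      obtain k j' where k: "k < Suc s" "j' < m k" "j = level_start m k + j'"
        using level_offset_below[OF jN] by blast
      then show ?thesis
        using U_row_solves[OF hess less y, of k j'] x by (cases "k = s") auto
    qed
    then have "y (level_start m s + i) = 0"
      using truncated_row_unique[OF cons irr, of "level_start m (Suc s)" y "\<lambda>_. 0"]
        level_offset_less[of i m s "Suc s"] i by simp
    moreover have "(\<Sum>i'<m s. x i' * 1\<^sub>m (m s) $$ (i', i)) = (\<Sum>i'<m s. if i' = i then x i' else 0)"
      using i by (intro sum.cong) auto
    ultimately show "x i = 0" using y[of i s] i by simp
  qed
  from mat_inv_left_kernel[OF U_pivot_carrier[of m q s] this]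
  show ?case by (simp add: U_invertible_def U_star_eq)
qed

text \<open>Gives each column finite support. Positive level sizes ensure that every state lies in
  some level.\<close>

lemma hessenberg_zero:
  assumes hess: "upper_block_Hessenberg m q" and m: "\<And>k. 0 < m k"
    and j: "j < m l" and i: "level_start m (Suc (Suc l)) \<le> i"
  shows "q i (level_start m l + j) = 0"
proof -
  have "i < level_start m (Suc i)" using level_start_ge[of m "Suc i"] m by simp
  then obtain k i' where k: "i' < m k" "i = level_start m k + i'"
    using level_offset_below by blast
  have "\<not> k < Suc (Suc l)" using level_offset_less[of i' m k "Suc (Suc l)"] k i by auto
  then have "block m q k l = 0\<^sub>m (m k) (m l)" using hess by (auto simp: upper_block_Hessenberg_def)
  then show ?thesis using block_entry[of i' m k j l q] k j by simp
qed

section \<open>Stationary vectors of the augmented truncations\<close>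

lemma alpha_hat_entry:
  assumes "k \<le> s" "j < m k"
  shows "alpha_hat m \<alpha> s $$ (0, level_start m k + j) = (if k = s then \<alpha> s $$ (0, j) else 0)"
proof -
  have "level_start m k + j < level_start m (Suc s)" using assms by (intro level_offset_less) auto
  moreover have "level_start m k + j \<in> level m s \<longleftrightarrow> k = s"
    using assms level_offset_less[of j m k s] by (cases "k = s") (auto simp: level_def level_start_Suc)
  ultimately show ?thesis by (auto simp: alpha_hat_def)
qed

lemma alpha_hat_prob:
  assumes "prob_row (m s) (\<alpha> s)"
  shows "(\<Sum>j<level_start m (Suc s). alpha_hat m \<alpha> s $$ (0, j)) = 1"
    and "j < level_start m (Suc s) \<Longrightarrow> 0 \<le> alpha_hat m \<alpha> s $$ (0, j)"
proof -
  have "(\<Sum>l<Suc s. \<Sum>j<m l. alpha_hat m \<alpha> s $$ (0, level_start m l + j)) =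
    (\<Sum>l<Suc s. if l = s then (\<Sum>j<m s. \<alpha> s $$ (0, j)) else 0)"
    by (intro sum.cong refl) (auto simp: alpha_hat_entry)
  then show "(\<Sum>j<level_start m (Suc s). alpha_hat m \<alpha> s $$ (0, j)) = 1"
    using assms by (simp add: sum_levels prob_row_def)
  assume "j < level_start m (Suc s)"
  then obtain k j' where "k < Suc s" "j' < m k" "j = level_start m k + j'"
    using level_offset_below by blast
  then show "0 \<le> alpha_hat m \<alpha> s $$ (0, j)"
    using assms by (auto simp: alpha_hat_entry prob_row_def)
qed

text \<open>Trades the matrix inverse for its linear system: \<open>x\<close> is the row before
  normalisation, accessible from here on through uniqueness and sign of solutions.\<close>

lemma pi_hat_solution:
  assumes cons: "conservative_Q_matrix q" and irr: "Q_irreducible q"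
  obtains x :: "nat \<Rightarrow> real" where
    "\<And>j. j < level_start m (Suc s) \<Longrightarrow>
       (\<Sum>i<level_start m (Suc s). x i * q i j) = - alpha_hat m \<alpha> s $$ (0, j)"
    "\<And>j. extend_row (pi_hat m q \<alpha> s) j =
       (if j < level_start m (Suc s) then x j / (\<Sum>i<level_start m (Suc s). x i) else 0)"
proof -
  define N where "N = level_start m (Suc s)"
  define T where "T = - trunc_Q m q s"
  have T: "T \<in> carrier_mat N N" by (simp add: T_def trunc_Q_def N_def)
  have T_entry: "T $$ (i, j) = - q i j" if "i < N" "j < N" for i j
    using that by (simp add: T_def trunc_Q_def N_def)
  have "\<forall>i<N. x i = 0" if x: "\<forall>j<N. (\<Sum>i<N. x i * T $$ (i, j)) = 0" for x
  proof -
    have "(\<Sum>i<N. x i * q i j) = (\<Sum>i<N. 0 * q i j)" if "j < N" for j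
      using x that by (simp add: T_entry sum_negf)
    then show ?thesis using truncated_row_unique[OF cons irr, of N x "\<lambda>_. 0"] by blast
  qed
  note inv = mat_inv_left_kernel[OF T this]
  have a: "alpha_hat m \<alpha> s \<in> carrier_mat 1 N" by (simp add: alpha_hat_def N_def)
  define X where "X = alpha_hat m \<alpha> s * mat_inv T"
  have X: "X \<in> carrier_mat 1 N" unfolding X_def by (rule mult_carrier_mat[OF a inv(1)])
  have XT: "X * T = alpha_hat m \<alpha> s"
    unfolding X_def by (simp add: assoc_mult_mat[OF a inv(1) T] inv(3) right_mult_one_mat[OF a])
  have ones: "ones_col N \<in> carrier_mat N 1" by (simp add: ones_col_def)
  have "(X * ones_col N) $$ (0, 0) = (\<Sum>i<N. X $$ (0, i))"
    using mat_mult_entry[OF X ones, of 0 0] by (simp add: ones_col_def)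
  then have pi: "pi_hat m q \<alpha> s = (1 / (\<Sum>i<N. X $$ (0, i))) \<cdot>\<^sub>m X"
    by (simp add: pi_hat_def Let_def X_def T_def N_def)
  show thesis
  proof (rule that)
    fix j assume "j < level_start m (Suc s)"
    then have "j < N" by (simp add: N_def)
    then have "(X * T) $$ (0, j) = - (\<Sum>i<N. X $$ (0, i) * q i j)"
      using mat_mult_entry[OF X T, of 0 j] by (simp add: T_entry sum_negf)
    then show "(\<Sum>i<level_start m (Suc s). X $$ (0, i) * q i j) = - alpha_hat m \<alpha> s $$ (0, j)"
      by (simp add: XT N_def)
  next
    fix j
    show "extend_row (pi_hat m q \<alpha> s) j =
       (if j < level_start m (Suc s) then X $$ (0, j) / (\<Sum>i<level_start m (Suc s). X $$ (0, i)) else 0)"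
      using X by (simp add: extend_row_def pi N_def)
  qed
qed

lemma Q_hat_entry:
  assumes "i < level_start m (Suc s)" "j < level_start m (Suc s)"
  shows "Q_hat m q \<alpha> s $$ (i, j) = q i j - (\<Sum>k<level_start m (Suc s). q i k) * alpha_hat m \<alpha> s $$ (0, j)"
proof -
  let ?N = "level_start m (Suc s)"
  have t: "trunc_Q m q s \<in> carrier_mat ?N ?N" and o: "ones_col ?N \<in> carrier_mat ?N 1"
    and a: "alpha_hat m \<alpha> s \<in> carrier_mat 1 ?N"
    by (simp_all add: trunc_Q_def ones_col_def alpha_hat_def)
  have to: "trunc_Q m q s * ones_col ?N \<in> carrier_mat ?N 1" by (rule mult_carrier_mat[OF t o])
  have "(trunc_Q m q s * ones_col ?N * alpha_hat m \<alpha> s) $$ (i, j) =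
      (\<Sum>k<?N. q i k) * alpha_hat m \<alpha> s $$ (0, j)"
    using mat_mult_entry[OF to a assms] mat_mult_entry[OF t o assms(1), of 0] assms
    by (simp add: trunc_Q_def ones_col_def)
  then show ?thesis
    unfolding Q_hat_def using assms t a to by (subst index_minus_mat) (auto simp: trunc_Q_def)
qed

context
  fixes q :: "nat \<Rightarrow> nat \<Rightarrow> real" and m :: "nat \<Rightarrow> nat" and \<alpha> :: "nat \<Rightarrow> real mat" and s :: nat
  assumes cons: "conservative_Q_matrix q" and irr: "Q_irreducible q"
    and alpha: "prob_row (m s) (\<alpha> s)"
begin

text \<open>The sign comes from the comparison lemma. A vanishing total would make \<open>x\<close>,
  hence \<open>alpha_hat\<close>, zero although the latter has mass one.\<close>

lemma resolvent_row:
  assumes x: "\<And>j. j < level_start m (Suc s) \<Longrightarrow>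
       (\<Sum>i<level_start m (Suc s). x i * q i j) = - alpha_hat m \<alpha> s $$ (0, j)"
  shows "i < level_start m (Suc s) \<Longrightarrow> 0 \<le> x i" and "0 < (\<Sum>i<level_start m (Suc s). x i)"
proof -
  show nonneg: "0 \<le> x i" if "i < level_start m (Suc s)" for i
    by (rule truncated_row_nonneg[OF cons irr _ that]) (simp add: x alpha_hat_prob(2)[of m s \<alpha>, OF alpha])
  have "(\<Sum>i<level_start m (Suc s). x i) \<noteq> 0"
  proof
    assume "(\<Sum>i<level_start m (Suc s). x i) = 0"
    then have "x i = 0" if "i < level_start m (Suc s)" for i
      using sum_nonneg_eq_0_iff[of "{..<level_start m (Suc s)}" x] nonneg that by auto
    then have "alpha_hat m \<alpha> s $$ (0, j) = 0" if "j < level_start m (Suc s)" for j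
      using x[OF that] by simp
    then show False using alpha_hat_prob(1)[of m s \<alpha>, OF alpha] by simp
  qed
  moreover have "0 \<le> (\<Sum>i<level_start m (Suc s). x i)" by (intro sum_nonneg nonneg) auto
  ultimately show "0 < (\<Sum>i<level_start m (Suc s). x i)" by simp
qed

lemma pi_hat_outside:
  assumes "level_start m (Suc s) \<le> i"
  shows "extend_row (pi_hat m q \<alpha> s) i = 0"
proof -
  obtain x where "\<And>j. extend_row (pi_hat m q \<alpha> s) j =
      (if j < level_start m (Suc s) then x j / (\<Sum>i<level_start m (Suc s). x i) else 0)"
    using pi_hat_solution[OF cons irr] by blast
  then show ?thesis using assms by simp
qed

lemma pi_hat_nonneg: "0 \<le> extend_row (pi_hat m q \<alpha> s) i"
  and pi_hat_sums: "extend_row (pi_hat m q \<alpha> s) sums 1"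
  and pi_hat_Q: "j < level_start m (Suc s) \<Longrightarrow> alpha_hat m \<alpha> s $$ (0, j) = 0 \<Longrightarrow>
    (\<Sum>i<level_start m (Suc s). extend_row (pi_hat m q \<alpha> s) i * q i j) = 0"
  and pi_hat_Q_hat: "j < level_start m (Suc s) \<Longrightarrow>
    (\<Sum>i<level_start m (Suc s). extend_row (pi_hat m q \<alpha> s) i * Q_hat m q \<alpha> s $$ (i, j)) = 0"
proof -
  let ?N = "level_start m (Suc s)" and ?a = "\<lambda>j. alpha_hat m \<alpha> s $$ (0, j)"
  obtain x where x: "\<And>j. j < ?N \<Longrightarrow> (\<Sum>i<?N. x i * q i j) = - ?a j"
    and p: "\<And>j. extend_row (pi_hat m q \<alpha> s) j = (if j < ?N then x j / (\<Sum>i<?N. x i) else 0)"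
    using pi_hat_solution[OF cons irr] by blast
  note xr = resolvent_row[OF x]
  show "0 \<le> extend_row (pi_hat m q \<alpha> s) i" using xr(1)[of i] xr(2) by (simp add: p)
  have "(\<Sum>i<?N. extend_row (pi_hat m q \<alpha> s) i) = 1"
    using xr(2) by (simp add: p flip: sum_divide_distrib)
  then show "extend_row (pi_hat m q \<alpha> s) sums 1"
    using sums_finite[of "{..<?N}" "extend_row (pi_hat m q \<alpha> s)"] by (simp add: p)
  show "(\<Sum>i<?N. extend_row (pi_hat m q \<alpha> s) i * q i j) = 0" if "j < ?N" "?a j = 0"
    using x[OF that(1)] that(2) by (simp add: p flip: sum_divide_distrib)
  show "(\<Sum>i<?N. extend_row (pi_hat m q \<alpha> s) i * Q_hat m q \<alpha> s $$ (i, j)) = 0" if j: "j < ?N"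
  proof -
    \<comment> \<open>Summed over all columns, the linear system says that the rate lost by
      truncation, weighted with \<open>x\<close>, is exactly one; the rank-one correction therefore
      puts back the missing \<open>alpha_hat\<close>.\<close>
    have "(\<Sum>i<?N. x i * (\<Sum>k<?N. q i k)) = (\<Sum>k<?N. \<Sum>i<?N. x i * q i k)"
      unfolding sum_distrib_left by (rule sum.swap)
    also have "\<dots> = - 1"
      using alpha_hat_prob(1)[of m s \<alpha>, OF alpha] by (simp add: x sum_negf)
    finally have *: "(\<Sum>i<?N. x i * (\<Sum>k<?N. q i k)) = - 1" .
    have "(\<Sum>i<?N. x i * Q_hat m q \<alpha> s $$ (i, j)) =
       (\<Sum>i<?N. x i * q i j) - (\<Sum>i<?N. x i * (\<Sum>k<?N. q i k)) * ?a j"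
      unfolding sum_distrib_right sum_subtractf[symmetric]
      using j by (intro sum.cong refl) (simp add: Q_hat_entry right_diff_distrib)
    also have "\<dots> = 0" using x[OF j] * by simp
    finally show ?thesis by (simp add: p flip: sum_divide_distrib)
  qed
qed

text \<open>Since \<open>U_star m q s\<close> inverts the last pivot, the elimination rows weighted
  with \<open>\<alpha> s * U_star m q s\<close> solve the linear system behind
  \<open>pi_hat\<close>; by uniqueness they agree before normalisation.\<close>

lemma pi_hat_eq_U:
  assumes hess: "upper_block_Hessenberg m q" and k: "k \<le> s" and j: "j < m k"
  shows "((1 / (\<alpha> s * mat_sum (m s) 1
            (\<lambda>l. U_star m q s * U_mat m q s l * ones_col (m l)) (Suc s)) $$ (0, 0))
          \<cdot>\<^sub>m (\<alpha> s * U_star m q s * U_mat m q s k)) $$ (0, j) =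
     extend_row (pi_hat m q \<alpha> s) (level_start m k + j)"
proof -
  let ?N = "level_start m (Suc s)"
  obtain x where x: "\<And>j. j < ?N \<Longrightarrow> (\<Sum>i<?N. x i * q i j) = - alpha_hat m \<alpha> s $$ (0, j)"
    and p: "\<And>j. extend_row (pi_hat m q \<alpha> s) j = (if j < ?N then x j / (\<Sum>i<?N. x i) else 0)"
    using pi_hat_solution[OF cons irr] by blast
  note inv = U_invertible_all[OF cons irr hess]
  have us: "U_star m q s \<in> carrier_mat (m s) (m s)" "U_star m q s * U_pivot m q s = 1\<^sub>m (m s)"
    using inv[of s] by (auto simp: U_invertible_def)
  have al: "\<alpha> s \<in> carrier_mat 1 (m s)" using alpha by (simp add: prob_row_def)
  have U: "U_mat m q s l \<in> carrier_mat (m s) (m l)" if "l \<le> s" for l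
    using U_mat_carrier inv that by blast
  define A where "A = \<alpha> s * U_star m q s"
  have A: "A \<in> carrier_mat 1 (m s)" unfolding A_def by (rule mult_carrier_mat[OF al us(1)])
  have AU: "A * U_mat m q s l \<in> carrier_mat 1 (m l)" if "l \<le> s" for l
    by (rule mult_carrier_mat[OF A U[OF that]])
  obtain y where y: "\<And>l j. j < m l \<Longrightarrow> y (level_start m l + j) = (\<Sum>i<m s. A $$ (0, i) * U_mat m q s l $$ (i, j))"
    using level_function_exists[of m "\<lambda>l j. \<Sum>i<m s. A $$ (0, i) * U_mat m q s l $$ (i, j)"] by blast
  have y': "(A * U_mat m q s l) $$ (0, j) = y (level_start m l + j)" if "l \<le> s" "j < m l" for l j
    using mat_mult_entry[OF A U[OF that(1)], of 0 j] y that by simp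
  have "A * U_pivot m q s = \<alpha> s"
    unfolding A_def by (simp add: assoc_mult_mat[OF al us(1) U_pivot_carrier[of m q s]] us(2) right_mult_one_mat[OF al])
  then have piv: "(\<Sum>i<m s. A $$ (0, i) * U_pivot m q s $$ (i, j)) = \<alpha> s $$ (0, j)" if "j < m s" for j
    using mat_mult_entry[OF A U_pivot_carrier[of m q s] _ that, of 0] by simp
  have "x t = y t" if "t < ?N" for t
  proof (rule truncated_row_unique[OF cons irr _ that])
    fix j assume jN: "j < ?N"
    then obtain l j' where l: "l < Suc s" "j' < m l" "j = level_start m l + j'"
      using level_offset_below by blast
    have "(\<Sum>i<?N. y i * q i j) = - alpha_hat m \<alpha> s $$ (0, j)"
      unfolding l(3)
      by (subst U_row_solves[OF hess inv y]) (use l piv in \<open>auto simp: alpha_hat_entry\<close>)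
    then show "(\<Sum>i<?N. x i * q i j) = (\<Sum>i<?N. y i * q i j)" using x[OF jN] by simp
  qed
  moreover have "level_start m k + j < ?N" using k j by (intro level_offset_less) auto
  ultimately have num: "(A * U_mat m q s k) $$ (0, j) = x (level_start m k + j)"
    and y_sum: "(\<Sum>t<?N. y t) = (\<Sum>t<?N. x t)"
    using y'[OF k j] by auto
  have ones: "ones_col (m l) \<in> carrier_mat (m l) 1" for l by (simp add: ones_col_def)
  have UU: "U_star m q s * U_mat m q s l \<in> carrier_mat (m s) (m l)" if "l \<le> s" for l
    by (rule mult_carrier_mat[OF us(1) U[OF that]])
  have "\<alpha> s * mat_sum (m s) 1 (\<lambda>l. U_star m q s * U_mat m q s l * ones_col (m l)) (Suc s) =
     mat_sum 1 1 (\<lambda>l. \<alpha> s * (U_star m q s * U_mat m q s l * ones_col (m l))) (Suc s)"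
    by (intro mult_mat_sum[OF al] mult_carrier_mat[OF UU ones]) simp
  then have "(\<alpha> s * mat_sum (m s) 1 (\<lambda>l. U_star m q s * U_mat m q s l * ones_col (m l)) (Suc s)) $$ (0, 0) =
    (\<Sum>l<Suc s. (\<alpha> s * (U_star m q s * U_mat m q s l * ones_col (m l))) $$ (0, 0))"
    by (simp add: mat_sum_entry)
  also have "\<dots> = (\<Sum>l<Suc s. \<Sum>t<m l. y (level_start m l + t))"
  proof (intro sum.cong refl)
    fix l assume "l \<in> {..<Suc s}"
    then have l: "l \<le> s" by simp
    have "\<alpha> s * (U_star m q s * U_mat m q s l * ones_col (m l)) = A * U_mat m q s l * ones_col (m l)"
      unfolding A_def assoc_mult_mat[OF al us(1) U[OF l]]
      by (rule assoc_mult_mat[OF al UU[OF l] ones, symmetric])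
    then show "(\<alpha> s * (U_star m q s * U_mat m q s l * ones_col (m l))) $$ (0, 0) =
       (\<Sum>t<m l. y (level_start m l + t))"
      using mat_mult_entry[OF AU[OF l] ones, of 0 0] y'[OF l] by (simp add: ones_col_def)
  qed
  also have "\<dots> = (\<Sum>t<?N. x t)" by (simp only: sum_levels[symmetric] y_sum)
  finally have den: "(\<alpha> s * mat_sum (m s) 1
     (\<lambda>l. U_star m q s * U_mat m q s l * ones_col (m l)) (Suc s)) $$ (0, 0) = (\<Sum>t<?N. x t)" .
  have "level_start m k + j < ?N" using k j by (intro level_offset_less) auto
  then show ?thesis
    unfolding den A_def[symmetric] using num carrier_matD[OF A] carrier_matD[OF U[OF k]] j by (simp add: p)
qed

end

theorem theorem3p1:
  fixes q :: "nat \<Rightarrow> nat \<Rightarrow> real"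
    and \<pi> :: "nat \<Rightarrow> real"
    and m :: "nat \<Rightarrow> nat"
    and \<alpha> :: "nat \<Rightarrow> real mat"
    and b b' :: real
    and v :: "nat \<Rightarrow> real"
    and C :: "nat set"
  assumes erg: "ergodic_generator q"
    and stat: "stationary_distribution q \<pi>"
    and levels: "\<And>k. 0 < m k"
    and hess: "upper_block_Hessenberg m q"
    and alpha: "\<And>s. prob_row (m s) (\<alpha> s)"
    and b: "0 < b" and b': "0 < b'"
    and v: "\<And>i. 1 \<le> v i"
    and C: "finite C"
    and c1: "\<And>i. summable (\<lambda>j. q i j * v j) \<and>
               (\<Sum>j. q i j * v j) \<le> - \<bar>q i i\<bar> - 1 + b * indicator C i"
    and c2: "\<And>s i. i < level_start m (Suc s) \<Longrightarrow>
               (\<Sum>j<level_start m (Suc s). Q_hat m q \<alpha> s $$ (i, j) * v j)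
                 \<le> - \<bar>q i i\<bar> - 1 + b' * indicator C i"
    and c3: "\<And>i. (\<lambda>s. \<Sum>j<level_start m (Suc s). Q_hat m q \<alpha> s $$ (i, j) * v j)
               \<longlonglongrightarrow> (\<Sum>j. q i j * v j)"
    and c4: "(SUP i\<in>- C. \<Sum>\<^sub>\<infinity>j\<in>- C.
                ennreal (q i j / (\<bar>q i i\<bar> + 1) * max (v j - v i) 0)) < \<infinity>"
  shows "(\<lambda>s. l1_norm (\<lambda>j. extend_row (pi_hat m q \<alpha> s) j - \<pi> j)) \<longlonglongrightarrow> 0 \<and>
         (\<forall>k. \<forall>j<m k.
            (\<lambda>s. ((1 / (\<alpha> s * mat_sum (m s) 1
                          (\<lambda>l. U_star m q s * U_mat m q s l * ones_col (m l)) (Suc s)) $$ (0, 0))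
                    \<cdot>\<^sub>m (\<alpha> s * U_star m q s * U_mat m q s k)) $$ (0, j))
              \<longlonglongrightarrow> row_block m \<pi> k $$ (0, j))"
proof -
  have cons: "conservative_Q_matrix q" using erg by (simp add: ergodic_generator_def)
  have irr: "Q_irreducible q" by (rule ergodic_generator_irreducible[OF erg])
  define p where "p s = extend_row (pi_hat m q \<alpha> s)" for s
  define w where "w s i = (\<Sum>j<level_start m (Suc s). Q_hat m q \<alpha> s $$ (i, j) * v j)" for s i
  define S where "S = (SUP i\<in>- C. \<Sum>\<^sub>\<infinity>j\<in>- C. ennreal (q i j / (\<bar>q i i\<bar> + 1) * max (v j - v i) 0))"
  note pi_facts = pi_hat_nonneg[where m = m and \<alpha> = \<alpha>, OF cons irr alpha] pi_hat_sums[where m = m and \<alpha> = \<alpha>, OF cons irr alpha]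
    pi_hat_Q[where m = m and \<alpha> = \<alpha>, OF cons irr alpha] pi_hat_Q_hat[where m = m and \<alpha> = \<alpha>, OF cons irr alpha]
  have p_zero: "p s i = 0" if "level_start m (Suc s) \<le> i" for s i
    unfolding p_def by (rule pi_hat_outside[where m = m and \<alpha> = \<alpha>, OF cons irr alpha that])
  have col: "finite {i. q i j \<noteq> 0} \<and> (\<forall>\<^sub>F s in sequentially. (\<Sum>i | q i j \<noteq> 0. p s i * q i j) = 0)" for j
  proof -
    have "j < level_start m (Suc j)" using level_start_ge[of m "Suc j"] levels by simp
    then obtain l j' where l: "j' < m l" "j = level_start m l + j'"
      using level_offset_below by blast
    have sub: "{i. q i j \<noteq> 0} \<subseteq> {..<level_start m (Suc (Suc l))}"
      using hessenberg_zero[OF hess levels l(1)] l(2) by (force simp: not_less[symmetric])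
    \<comment> \<open>One level beyond that of \<open>j\<close> suffices: the truncation then
      contains the whole support of column \<open>j\<close>, and \<open>alpha_hat\<close>, living on
      level \<open>s\<close>, vanishes at \<open>j\<close>.\<close>
    have "(\<Sum>i | q i j \<noteq> 0. p s i * q i j) = 0" if s: "Suc l \<le> s" for s
    proof -
      have "level_start m (Suc (Suc l)) \<le> level_start m (Suc s)" using s by (intro level_start_mono) simp
      then have "(\<Sum>i | q i j \<noteq> 0. p s i * q i j) = (\<Sum>i<level_start m (Suc s). p s i * q i j)"
        using sub by (intro sum.mono_neutral_left) auto
      moreover have "j < level_start m (Suc s)" using l s by (auto intro: level_offset_less)
      moreover have "alpha_hat m \<alpha> s $$ (0, j) = 0" using l s by (simp add: alpha_hat_entry)
      ultimately show ?thesis using pi_facts(3)[of j s] by (simp add: p_def)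
    qed
    then show ?thesis
      using finite_subset[OF sub] eventually_sequentiallyI[of "Suc l"] by simp
  qed
  have up: "(\<Sum>j\<in>F. q i j * max (v j - v i) 0) \<le> enn2real S * (\<bar>q i i\<bar> + 1)"
    if i: "i \<notin> C" and F: "finite F" "F \<subseteq> - C" for i F
  proof -
    \<comment> \<open>At \<open>j = i\<close> the negative rate is multiplied by
      \<open>max (v i - v i) 0 = 0\<close>, so \<open>ennreal\<close> cuts nothing off.\<close>
    have nonneg: "0 \<le> q i j / (\<bar>q i i\<bar> + 1) * max (v j - v i) 0" for j
      using Q_nonneg[OF cons, of i j] by (cases "i = j") auto
    have "ennreal (\<Sum>j\<in>F. q i j / (\<bar>q i i\<bar> + 1) * max (v j - v i) 0) =
       (\<Sum>j\<in>F. ennreal (q i j / (\<bar>q i i\<bar> + 1) * max (v j - v i) 0))"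
      by (rule sum_ennreal[symmetric]) (rule nonneg)
    also have "\<dots> \<le> (\<Sum>\<^sub>\<infinity>j\<in>- C. ennreal (q i j / (\<bar>q i i\<bar> + 1) * max (v j - v i) 0))"
      unfolding nonneg_infsum_complete[OF zero_le] using F by (intro SUP_upper) simp
    also have "\<dots> \<le> S" unfolding S_def using i by (intro SUP_upper) simp
    also have "S = ennreal (enn2real S)" using c4 by (simp add: S_def)
    finally have "(\<Sum>j\<in>F. q i j / (\<bar>q i i\<bar> + 1) * max (v j - v i) 0) \<le> enn2real S"
      by simp
    moreover have "(\<Sum>j\<in>F. q i j / (\<bar>q i i\<bar> + 1) * max (v j - v i) 0) =
       (\<Sum>j\<in>F. q i j * max (v j - v i) 0) / (\<bar>q i i\<bar> + 1)"
      by (simp add: sum_divide_distrib)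
    ultimately show ?thesis by (simp add: divide_le_eq add_pos_nonneg)
  qed
  have l1: "(\<lambda>s. l1_norm (\<lambda>i. p s i - \<pi> i)) \<longlonglongrightarrow> 0"
  proof (rule drift_bounded_l1_limit[OF cons irr stat _ _ _ C up, where w = w and b' = b'])
    show "0 \<le> v i" for i using v[of i] by simp
    show "summable (\<lambda>j. q i j * v j)" for i using c1 by blast
    show "0 \<le> p s i" "p s sums 1" for s i using pi_facts by (simp_all add: p_def)
    show "(\<lambda>s. w s i) \<longlonglongrightarrow> (\<Sum>j. q i j * v j)" for i unfolding w_def by (rule c3)
    show "p s i * w s i \<le> p s i * (- \<bar>q i i\<bar> - 1 + b' * indicator C i)" for s i
    proof (cases "i < level_start m (Suc s)")
      case True
      then show ?thesis using c2[OF True] pi_facts(1)[of s i]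
        by (intro mult_left_mono) (simp_all add: w_def p_def)
    qed (simp add: p_zero)
    show "(\<lambda>i. p s i * w s i) sums 0" for s
    proof -
      let ?N = "level_start m (Suc s)"
      have "(\<Sum>i<?N. p s i * w s i) = (\<Sum>j<?N. \<Sum>i<?N. p s i * Q_hat m q \<alpha> s $$ (i, j) * v j)"
        unfolding w_def sum_distrib_left mult.assoc by (rule sum.swap)
      also have "\<dots> = 0"
        using pi_facts(4)[of _ s] by (simp add: p_def flip: sum_distrib_right)
      finally show ?thesis
        using sums_finite[of "{..<?N}" "\<lambda>i. p s i * w s i"] p_zero by simp
    qed
  qed (use col in auto)
  have "(\<lambda>s. p s i) \<longlonglongrightarrow> \<pi> i" for i
  proof -
    have "\<bar>p s i - \<pi> i\<bar> \<le> l1_norm (\<lambda>i. p s i - \<pi> i)" for s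
    proof -
      have \<pi>: "\<pi> sums 1" "\<And>i. 0 < \<pi> i" using stat by (auto simp: stationary_distribution_def)
      have "summable (\<lambda>i. p s i + \<pi> i)"
        using pi_facts(2)[of s] \<pi>(1) by (intro summable_add) (auto simp: p_def sums_iff)
      then have "summable (\<lambda>i. \<bar>p s i - \<pi> i\<bar>)"
      proof (rule summable_comparison_test')
        show "norm \<bar>p s i - \<pi> i\<bar> \<le> p s i + \<pi> i" for i
          using pi_facts(1)[of s i] \<pi>(2)[of i] by (simp add: p_def)
      qed
      from sum_le_suminf[OF this, of "{i}"] show ?thesis by (simp add: l1_norm_def)
    qed
    then have "(\<lambda>s. p s i - \<pi> i) \<longlonglongrightarrow> 0"
      by (intro Lim_null_comparison[OF _ l1]) simp
    then show ?thesis by (simp add: LIM_zero_iff)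
  qed
  note p_lim = this
  show ?thesis
  proof (intro conjI allI impI)
    show "(\<lambda>s. l1_norm (\<lambda>j. extend_row (pi_hat m q \<alpha> s) j - \<pi> j)) \<longlonglongrightarrow> 0"
      using l1 by (simp add: p_def)
  next
    fix k j assume j: "j < m k"
    \<comment> \<open>For \<open>s < k\<close> level \<open>k\<close> lies outside the truncation,
      so agreement with the block formula is only eventual.\<close>
    have "\<forall>\<^sub>F s in sequentially. p s (level_start m k + j) =
      ((1 / (\<alpha> s * mat_sum (m s) 1
                          (\<lambda>l. U_star m q s * U_mat m q s l * ones_col (m l)) (Suc s)) $$ (0, 0))
                    \<cdot>\<^sub>m (\<alpha> s * U_star m q s * U_mat m q s k)) $$ (0, j)"
      using eventually_ge_at_top[of k]
      by eventually_elim (simp only: p_def pi_hat_eq_U[where m = m and \<alpha> = \<alpha>, OF cons irr alpha hess _ j])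
    moreover have "row_block m \<pi> k $$ (0, j) = \<pi> (level_start m k + j)"
      using j by (simp add: row_block_def)
    ultimately show "(\<lambda>s. ((1 / (\<alpha> s * mat_sum (m s) 1
                          (\<lambda>l. U_star m q s * U_mat m q s l * ones_col (m l)) (Suc s)) $$ (0, 0))
                    \<cdot>\<^sub>m (\<alpha> s * U_star m q s * U_mat m q s k)) $$ (0, j))
              \<longlonglongrightarrow> row_block m \<pi> k $$ (0, j)"
      using Lim_transform_eventually[OF p_lim] by simp
  qed
qed

end
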